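(* Let $\beta=(\beta_n)_{n\ge0}$ be an essentially decreasing sequence of positive numbers satisfying $\liminf_{n\to\infty}\beta_n^{1/n}\ge 1$. The following assertions are equivalent: 1) for every symbol $\phi$, the composition operator $C_\phi$ is bounded on $H^2(\beta)$; 2) for every $a\in(0,1)$, $C_{T_a}$ is bounded on $H^2(\beta)$; 3) for some $a\in(0,1)$, $C_{T_a}$ is bounded on $H^2(\beta)$; 4) $\beta$ satisfies the $\Delta_2$-condition.
   Context: $\mathbb D$ is the open unit disk. For a sequence $\beta=(\beta_n)_{n\ge0}$ of positive numbers with $\liminf_n \beta_n^{1/n}\ge1$, $H^2(\beta)$ is the Hilbert space of analytic functions $f(z)=\sum_{n\ge0}a_nz^n$ on $\mathbb D$ with $\|f\|^2=\sum_{n\ge0}|a_n|^2\beta_n<\infty$. A symbol is a non-constant analytic map $\phi:\mathbb D\to\mathbb D$, and $C_\phi f=f\circ\phi$; "$C_\phi$ is bounded on $H^2(\beta)$" means $C_\phi$ maps $H^2(\beta)$ into itself (hence boundedly). For $a\in\mathbb D$, $T_a(z)=\frac{a+z}{1+\bar a z}$. $\beta$ is essentially decreasing if there is $C\ge1$ with $\beta_m\le C\beta_n$ for all $m\ge n\ge0$. $\beta$ satisfies the $\Delta_2$-condition if there is $\delta\in(0,1)$ with $\beta_{2n}\ge\delta\beta_n$ for all $n\ge0$. *)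

theory Defs
  imports "HOL-Analysis.Analysis" "HOL-Library.Liminf_Limsup"
begin

definition in_H2 :: "(nat \<Rightarrow> real) \<Rightarrow> (complex \<Rightarrow> complex) \<Rightarrow> bool" where
  "in_H2 \<beta> f \<longleftrightarrow> f holomorphic_on ball 0 1 \<and>
     (\<exists>a :: nat \<Rightarrow> complex. (\<forall>z \<in> ball 0 1. (\<lambda>n. a n * z ^ n) sums f z) \<and>
        summable (\<lambda>n. (norm (a n))\<^sup>2 * \<beta> n))"

definition symbol :: "(complex \<Rightarrow> complex) \<Rightarrow> bool" where
  "symbol \<phi> \<longleftrightarrow> \<phi> holomorphic_on ball 0 1 \<and> \<phi> ` ball 0 1 \<subseteq> ball 0 1 \<and>
     \<not> (\<exists>c. \<forall>z \<in> ball 0 1. \<phi> z = c)"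

definition comp_bounded :: "(nat \<Rightarrow> real) \<Rightarrow> (complex \<Rightarrow> complex) \<Rightarrow> bool" where
  "comp_bounded \<beta> \<phi> \<longleftrightarrow> (\<forall>f. in_H2 \<beta> f \<longrightarrow> in_H2 \<beta> (f \<circ> \<phi>))"

definition T :: "complex \<Rightarrow> complex \<Rightarrow> complex" where
  "T a z = (a + z) / (1 + cnj a * z)"

definition ess_decreasing :: "(nat \<Rightarrow> real) \<Rightarrow> bool" where
  "ess_decreasing \<beta> \<longleftrightarrow> (\<exists>C \<ge> 1. \<forall>m n. n \<le> m \<longrightarrow> \<beta> m \<le> C * \<beta> n)"

definition Delta2 :: "(nat \<Rightarrow> real) \<Rightarrow> bool" where
  "Delta2 \<beta> \<longleftrightarrow> (\<exists>\<delta>. 0 < \<delta> \<and> \<delta> < 1 \<and> (\<forall>n. \<beta> (2 * n) \<ge> \<delta> * \<beta> n))"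

end

theory Submission
  imports Defs "HOL-Complex_Analysis.Complex_Analysis"
begin

text \<open>
  Sufficiency of the \<open>\<Delta>\<^sub>2\<close>-condition: the part of \<open>f\<close> of degree at least \<open>M k\<close> contributes only a bounded
  amount to the first \<open>k\<close> Taylor coefficients of \<open>f \<circ> \<phi>\<close>, because on the circle \<open>\<bar>z\<bar> = 1/2\<close> the powers
  of \<open>\<phi>\<close> decay geometrically while \<open>\<beta>\<close> decays subexponentially.  The part of lower degree is controlled
  in the Hardy space by Littlewood's subordination principle.  Hence the partial sums of the squared
  coefficients of \<open>f \<circ> \<phi>\<close> up to \<open>k\<close> are dominated by those of \<open>f\<close> up to \<open>M k\<close>, and summation by parts
  against a decreasing weight, with \<open>M\<close> a power of two, gives the weighted estimate.

  Necessity: if \<open>f \<mapsto> f \<circ> T\<^sub>a\<close> acts on the space, then the squared norm of \<open>T\<^sub>a\<^sup>n\<close> is \<open>O(\<beta>\<^sub>n)\<close>.  On the quarter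
  circle of radius \<open>r\<close> with nonnegative real and imaginary parts, \<open>\<bar>T\<^sub>a\<bar>\<^sup>2 \<ge> 1 - (1 - r\<^sup>2)(1 - a\<^sup>2)\<close>; taking
  \<open>1 - r\<^sup>2 = s / n\<close> with \<open>s\<close> large, Parseval's identity shows that a fixed proportion of the Hardy norm of
  \<open>T\<^sub>a\<^sup>n\<close> sits on frequencies at most \<open>l n\<close>, where \<open>l = 1 - a\<^sup>2 / 2 < 1\<close>.  So \<open>\<beta>\<close> at \<open>l n\<close> is \<open>O(\<beta>\<^sub>n)\<close>, and
  iterating this yields the \<open>\<Delta>\<^sub>2\<close>-condition.
\<close>

section \<open>Taylor coefficients and means over circles\<close>

lemma cmod_add_squared_Re: "(cmod (u + v))\<^sup>2 = (cmod u)\<^sup>2 + (cmod v)\<^sup>2 + 2 * Re (u * cnj v)"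
  unfolding cmod_power2 by (simp add: power2_eq_square algebra_simps)

text \<open>A relation between function and coefficients, so that expansions combine linearly and
  \<open>in_H2\<close> amounts to an expansion together with summability.\<close>

definition has_taylor :: "(complex \<Rightarrow> complex) \<Rightarrow> (nat \<Rightarrow> complex) \<Rightarrow> bool" where
  "has_taylor g b \<longleftrightarrow> (\<forall>z \<in> ball 0 1. (\<lambda>n. b n * z ^ n) sums g z)"

lemma has_taylor_holomorphic: "has_taylor g b \<Longrightarrow> g holomorphic_on ball 0 1"
  unfolding has_taylor_def using power_series_holomorphic[of 0 1 b g] by simp

lemma holomorphic_has_taylor:
  assumes "g holomorphic_on ball 0 1"
  obtains b where "has_taylor g b"
proof (rule that)
  show "has_taylor g (\<lambda>n. (deriv ^^ n) g 0 / fact n)"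
    using holomorphic_power_series[OF assms] unfolding has_taylor_def by simp
qed

lemma has_taylor_0: "has_taylor g b \<Longrightarrow> g 0 = b 0"
  unfolding has_taylor_def using sums_unique2[OF _ powser_sums_zero, of b "g 0"]
  by (auto dest: bspec[of _ _ 0])

lemma has_taylor_diff: "has_taylor f a \<Longrightarrow> has_taylor g b \<Longrightarrow> has_taylor (\<lambda>z. f z - g z) (\<lambda>n. a n - b n)"
  unfolding has_taylor_def by (simp add: left_diff_distrib sums_diff)

lemma has_taylor_scale: "has_taylor f a \<Longrightarrow> has_taylor (\<lambda>z. c * f z) (\<lambda>n. c * a n)"
  unfolding has_taylor_def by (auto simp: mult.assoc intro!: sums_mult)

lemma has_taylor_sum:
  assumes "\<And>i. i \<in> I \<Longrightarrow> has_taylor (f i) (a i)"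
  shows "has_taylor (\<lambda>z. \<Sum>i\<in>I. f i z) (\<lambda>n. \<Sum>i\<in>I. a i n)"
  using assms unfolding has_taylor_def by (auto simp: sum_distrib_right intro!: sums_sum)

lemma has_taylor_add_const:
  assumes "has_taylor g b"
  shows "has_taylor (\<lambda>z. c + g z) (b(0 := c + b 0))"
  unfolding has_taylor_def
proof
  fix z :: complex assume z: "z \<in> ball 0 1"
  have "(\<lambda>n. (if n = 0 then c else 0) + b n * z ^ n) sums (c + g z)"
    using assms z unfolding has_taylor_def by (intro sums_add sums_single) auto
  also have "(\<lambda>n. (if n = 0 then c else 0) + b n * z ^ n) = (\<lambda>n. (b(0 := c + b 0)) n * z ^ n)"
    by auto
  finally show "(\<lambda>n. (b(0 := c + b 0)) n * z ^ n) sums (c + g z)" .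
qed

lemma has_taylor_norm_summable:
  assumes "has_taylor g b" "0 \<le> r" "r < 1"
  shows "summable (\<lambda>n. cmod (b n) * r ^ n)"
proof -
  have n: "cmod (complex_of_real ((1 + r) / 2)) = (1 + r) / 2"
    unfolding norm_of_real using assms by simp
  then have "complex_of_real ((1 + r) / 2) \<in> ball 0 1" using assms by simp
  then have "summable (\<lambda>n. b n * complex_of_real ((1 + r) / 2) ^ n)"
    using assms(1) unfolding has_taylor_def by (auto simp: sums_iff)
  then have "summable (\<lambda>n. norm (b n * of_real r ^ n))"
    by (rule powser_insidea) (use assms n in simp)
  then show ?thesis using assms by (simp add: norm_mult norm_power)
qed

text \<open>The squared mean-square norm on the circle of radius \<open>r\<close>; for holomorphic
  \<open>g\<close> its supremum over \<open>r < 1\<close> is the squared Hardy norm.\<close>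

definition circle_mean :: "real \<Rightarrow> (complex \<Rightarrow> complex) \<Rightarrow> real" where
  "circle_mean r g = integral {0..2*pi} (\<lambda>t. (cmod (g (of_real r * cis t)))\<^sup>2) / (2 * pi)"

lemma cis_has_integral_0:
  fixes k :: int
  assumes "k \<noteq> 0"
  shows "((\<lambda>t. cis (of_int k * t)) has_integral 0) {0..2*pi}"
proof -
  have "((\<lambda>t. cis (of_int k * t)) has_integral
      (cis (of_int k * (2 * pi)) / (\<i> * of_int k) - cis (of_int k * 0) / (\<i> * of_int k))) {0..2*pi}"
    using assms
    by (intro fundamental_theorem_of_calculus)
       (auto intro!: derivative_eq_intros ext simp: has_vector_derivative_def field_simps scaleR_conv_of_real)
  moreover have "cis (of_int k * (2 * pi)) = 1"
    using cis_multiple_2pi[of "of_int k"] by (simp add: mult_ac)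
  ultimately show ?thesis by simp
qed

text \<open>Adding the term of degree \<open>N\<close> creates only cross terms of frequency
  \<open>n - N\<close> with \<open>n < N\<close>; these frequencies are nonzero, so the terms
  integrate to zero over a period.\<close>

lemma integral_norm_square_polynomial:
  "((\<lambda>t. (cmod (\<Sum>n<N. b n * (of_real r * cis t) ^ n))\<^sup>2) has_integral
     2 * pi * (\<Sum>n<N. (cmod (b n))\<^sup>2 * r ^ (2 * n))) {0..2*pi}"
proof (induction N)
  case (Suc N)
  let ?S = "\<lambda>t. \<Sum>n<N. b n * (of_real r * cis t) ^ n"
  let ?u = "\<lambda>t. b N * (of_real r * cis t) ^ N"
  have *: "(\<lambda>t. ?S t * cnj (?u t)) =
      (\<lambda>t. \<Sum>n<N. (b n * cnj (b N) * of_real r ^ (n + N)) * cis (of_int (int n - int N) * t))"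
    unfolding sum_distrib_right
    by (intro ext sum.cong refl)
       (simp add: power_mult_distrib Complex.DeMoivre cis_cnj power_add left_diff_distrib cis_mult)
  have "((\<lambda>t. ?S t * cnj (?u t)) has_integral (\<Sum>n<N. (b n * cnj (b N) * of_real r ^ (n + N)) * 0)) {0..2*pi}"
    unfolding * by (intro has_integral_sum finite_lessThan has_integral_mult_right cis_has_integral_0) auto
  from has_integral_linear[OF this bounded_linear_Re]
  have cross: "((\<lambda>t. Re (?S t * cnj (?u t))) has_integral 0) {0..2*pi}"
    by (simp only: o_def mult_zero_right sum.neutral_const zero_complex.sel)
  have "(cmod (?u t))\<^sup>2 = (cmod (b N))\<^sup>2 * r ^ (2 * N)" for t
    by (simp add: norm_mult norm_power power_mult_distrib power_even_eq flip: power_abs)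
  then have "((\<lambda>t. (cmod (?u t))\<^sup>2) has_integral (2 * pi * ((cmod (b N))\<^sup>2 * r ^ (2 * N)))) {0..2*pi}"
    using has_integral_const_real[of "(cmod (b N))\<^sup>2 * r ^ (2 * N)" 0 "2 * pi"] by simp
  from has_integral_add[OF has_integral_add[OF Suc.IH this] has_integral_mult_right[OF cross, of 2]]
  show ?case by (simp add: cmod_add_squared_Re distrib_left)
qed simp

text \<open>The partial sums converge pointwise on the circle and are bounded by \<open>A\<close>,
  so dominated convergence carries the polynomial case to the limit.\<close>

lemma parseval:
  assumes g: "has_taylor g b" and r: "0 \<le> r" "r < 1"
  shows "(\<lambda>n. (cmod (b n))\<^sup>2 * r ^ (2 * n)) sums circle_mean r g"
proof -
  define h where "h = (\<lambda>N t. (cmod (\<Sum>n<N. b n * (of_real r * cis t) ^ n))\<^sup>2)"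
  define A where "A = (\<Sum>n. cmod (b n) * r ^ n)"
  have sumb: "summable (\<lambda>n. cmod (b n) * r ^ n)"
    by (rule has_taylor_norm_summable[OF g r])
  have hI: "(h N has_integral 2 * pi * (\<Sum>n<N. (cmod (b n))\<^sup>2 * r ^ (2 * n))) {0..2*pi}" for N
    unfolding h_def by (rule integral_norm_square_polynomial)
  have le: "norm (h N t) \<le> A\<^sup>2" for N t
  proof -
    have "cmod (\<Sum>n<N. b n * (of_real r * cis t) ^ n) \<le> (\<Sum>n<N. cmod (b n) * r ^ n)"
      using r by (intro order.trans[OF norm_sum] sum_mono) (simp add: norm_mult norm_power)
    also have "\<dots> \<le> A"
      unfolding A_def using r by (intro sum_le_suminf sumb) auto
    finally show ?thesis unfolding h_def by (simp add: power_mono)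
  qed
  have conv: "(\<lambda>N. h N t) \<longlonglongrightarrow> (cmod (g (of_real r * cis t)))\<^sup>2" for t
  proof -
    have "of_real r * cis t \<in> ball 0 1" using r by (simp add: norm_mult)
    then have "(\<lambda>n. b n * (of_real r * cis t) ^ n) sums g (of_real r * cis t)"
      using g unfolding has_taylor_def by blast
    then show ?thesis unfolding h_def sums_def by (intro tendsto_intros)
  qed
  have "(\<lambda>N. integral {0..2*pi} (h N)) \<longlonglongrightarrow> integral {0..2*pi} (\<lambda>t. (cmod (g (of_real r * cis t)))\<^sup>2)"
    by (rule dominated_convergence(2)[where h = "\<lambda>_. A\<^sup>2"]) (use hI le conv in auto)
  then have "(\<lambda>N. 2 * pi * (\<Sum>n<N. (cmod (b n))\<^sup>2 * r ^ (2 * n))) \<longlonglongrightarrow> 2 * pi * circle_mean r g"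
    using integral_unique[OF hI] unfolding circle_mean_def by simp
  from tendsto_divide[OF this tendsto_const[of "2 * pi"]] show ?thesis
    unfolding sums_def by simp
qed

lemma circle_integrable:
  assumes "g holomorphic_on ball 0 1" "0 \<le> r" "r < 1"
  shows "(\<lambda>t. (cmod (g (of_real r * cis t)))\<^sup>2) integrable_on {a..b}"
proof -
  have "continuous_on {a..b} (\<lambda>t. g (of_real r * cis t))"
    by (rule continuous_on_compose2[OF holomorphic_on_imp_continuous_on[OF assms(1)]])
       (use assms in \<open>auto intro!: continuous_intros simp: norm_mult\<close>)
  then show ?thesis by (intro integrable_continuous_interval continuous_intros)
qed

lemma circle_mean_mono:
  assumes "g holomorphic_on ball 0 1" "h holomorphic_on ball 0 1" "0 \<le> r" "r < 1"
    and "\<And>z. cmod z = r \<Longrightarrow> cmod (g z) \<le> cmod (h z)"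
  shows "circle_mean r g \<le> circle_mean r h"
  unfolding circle_mean_def
  by (intro divide_right_mono integral_le circle_integrable power_mono assms)
     (use assms in \<open>auto simp: norm_mult\<close>)

lemma circle_mean_le:
  assumes "g holomorphic_on ball 0 1" "0 \<le> r" "r < 1" "\<And>z. cmod z = r \<Longrightarrow> cmod (g z) \<le> B"
  shows "circle_mean r g \<le> B\<^sup>2"
proof -
  have "0 \<le> B" using norm_ge_zero[of "g (of_real r)"] assms(4)[of "of_real r"] assms(2)
    by (simp del: norm_ge_zero)
  then have "circle_mean r g \<le> circle_mean r (\<lambda>_. of_real B)"
    by (intro circle_mean_mono assms(1-3) holomorphic_intros) (use assms(4) \<open>0 \<le> B\<close> in simp)
  also have "\<dots> = B\<^sup>2" unfolding circle_mean_def by simp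
  finally show ?thesis .
qed

text \<open>Removing the weights costs a factor \<open>r ^ (2 * k)\<close>. There are two uses:
  \<open>r\<close> tending to 1 for Hardy bounds, and \<open>r = 1/2\<close> for remainders that are
  small on that circle.\<close>

lemma taylor_partial_sum_le:
  assumes "has_taylor g b" "0 < r" "r < 1"
  shows "(\<Sum>n<k. (cmod (b n))\<^sup>2) \<le> circle_mean r g / r ^ (2 * k)"
proof -
  have "(\<Sum>n<k. (cmod (b n))\<^sup>2) * r ^ (2 * k) \<le> (\<Sum>n<k. (cmod (b n))\<^sup>2 * r ^ (2 * n))"
    unfolding sum_distrib_right using assms
    by (intro sum_mono mult_left_mono power_decreasing) auto
  also have "\<dots> \<le> circle_mean r g"
    using parseval[of g b r] assms sum_le_suminf[of "\<lambda>n. (cmod (b n))\<^sup>2 * r ^ (2 * n)" "{..<k}"]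
    by (simp add: sums_iff)
  finally show ?thesis using assms by (simp add: pos_le_divide_eq)
qed

lemma taylor_sum_le_of_circle_means:
  assumes g: "has_taylor g b" and B: "\<And>r. 0 < r \<Longrightarrow> r < 1 \<Longrightarrow> circle_mean r g \<le> B"
  shows "(\<Sum>n<k. (cmod (b n))\<^sup>2) \<le> B"
proof (rule tendsto_upperbound)
  show "((\<lambda>r. (\<Sum>n<k. (cmod (b n))\<^sup>2) * r ^ (2 * k)) \<longlongrightarrow> (\<Sum>n<k. (cmod (b n))\<^sup>2)) (at_left 1)"
    by (auto intro!: tendsto_eq_intros)
  show "\<forall>\<^sub>F r in at_left 1. (\<Sum>n<k. (cmod (b n))\<^sup>2) * r ^ (2 * k) \<le> B"
    using eventually_at_left_real[of 0 "1::real"]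
  proof (rule eventually_mono)
    fix r :: real assume r: "r \<in> {0<..<1}"
    then have "(\<Sum>n<k. (cmod (b n))\<^sup>2) \<le> circle_mean r g / r ^ (2 * k)"
      by (intro taylor_partial_sum_le g) auto
    then show "(\<Sum>n<k. (cmod (b n))\<^sup>2) * r ^ (2 * k) \<le> B"
      using B[of r] r by (simp add: pos_le_divide_eq)
  qed simp
qed simp

lemma taylor_sum_le_of_bounded:
  assumes "has_taylor g b" "\<And>z. z \<in> ball 0 1 \<Longrightarrow> cmod (g z) \<le> B"
  shows "(\<Sum>n<k. (cmod (b n))\<^sup>2) \<le> B\<^sup>2"
  by (intro taylor_sum_le_of_circle_means[OF assms(1)] circle_mean_le has_taylor_holomorphic[OF assms(1)])
     (use assms in auto)

section \<open>Littlewood's subordination principle\<close>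

text \<open>Changing the constant term only changes the zeroth coefficient in Parseval's identity, and
  multiplication by \<open>\<phi>\<close> is a contraction.\<close>

lemma circle_mean_add_const_mult:
  assumes \<phi>: "\<phi> holomorphic_on ball 0 1" "\<phi> ` ball 0 1 \<subseteq> ball 0 1"
    and h: "h holomorphic_on ball 0 1" and r: "0 \<le> r" "r < 1"
  shows "circle_mean r (\<lambda>z. c + \<phi> z * h z) \<le> (cmod (c + \<phi> 0 * h 0))\<^sup>2 + circle_mean r h"
proof -
  have hol: "(\<lambda>z. \<phi> z * h z) holomorphic_on ball 0 1"
    using \<phi> h by (intro holomorphic_intros)
  then obtain b where b: "has_taylor (\<lambda>z. \<phi> z * h z) b" by (rule holomorphic_has_taylor)
  have b0: "b 0 = \<phi> 0 * h 0" using has_taylor_0[OF b] by simp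
  have P: "(\<lambda>n. (cmod (b n))\<^sup>2 * r ^ (2 * n)) sums circle_mean r (\<lambda>z. \<phi> z * h z)"
    by (rule parseval[OF b r])
  have Q: "(\<lambda>n. (cmod ((b(0 := c + b 0)) n))\<^sup>2 * r ^ (2 * n)) sums circle_mean r (\<lambda>z. c + \<phi> z * h z)"
    by (rule parseval[OF has_taylor_add_const[OF b] r])
  have "(\<lambda>n. if n = 0 then (cmod (c + b 0))\<^sup>2 else 0) sums (cmod (c + b 0))\<^sup>2"
    by (rule sums_single)
  from sums_le[OF _ Q sums_add[OF this P]]
  have "circle_mean r (\<lambda>z. c + \<phi> z * h z) \<le> (cmod (c + b 0))\<^sup>2 + circle_mean r (\<lambda>z. \<phi> z * h z)"
    using r by auto
  moreover have "circle_mean r (\<lambda>z. \<phi> z * h z) \<le> circle_mean r h"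
  proof (rule circle_mean_mono[OF hol h r])
    fix z :: complex assume "cmod z = r"
    then have "cmod (\<phi> z) \<le> 1" using \<phi> r by (auto simp: image_subset_iff intro: less_imp_le)
    then show "cmod (\<phi> z * h z) \<le> cmod (h z)"
      by (simp add: norm_mult mult_left_le_one_le)
  qed
  ultimately show ?thesis by (simp add: b0)
qed

text \<open>Convexity of the squared modulus: \<open>c + a * w\<close> combines
  \<open>c / (1 - cmod a)\<close> and a rotation of \<open>w\<close> with weights
  \<open>1 - cmod a\<close> and \<open>cmod a\<close>. The convexity defect is the square that is
  discarded.\<close>

lemma norm_add_mult_square_le:
  assumes "cmod a < 1"
  shows "(cmod (c + a * w))\<^sup>2 \<le> (cmod c)\<^sup>2 / (1 - cmod a) + cmod a * (cmod w)\<^sup>2"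
proof -
  let ?\<alpha> = "cmod a"
  have "cmod (c + a * w) \<le> cmod c + ?\<alpha> * cmod w"
    by (metis norm_mult norm_triangle_ineq)
  then have "(cmod (c + a * w))\<^sup>2 \<le> (cmod c + ?\<alpha> * cmod w)\<^sup>2"
    by (intro power_mono) auto
  then have "(1 - ?\<alpha>) * (cmod (c + a * w))\<^sup>2 \<le> (1 - ?\<alpha>) * (cmod c + ?\<alpha> * cmod w)\<^sup>2"
    using assms by (intro mult_left_mono) auto
  also have "\<dots> = (cmod c)\<^sup>2 + ?\<alpha> * (1 - ?\<alpha>) * (cmod w)\<^sup>2 - ?\<alpha> * (cmod c - (1 - ?\<alpha>) * cmod w)\<^sup>2"
    by (simp add: power2_eq_square algebra_simps)
  also have "\<dots> \<le> (cmod c)\<^sup>2 + ?\<alpha> * (1 - ?\<alpha>) * (cmod w)\<^sup>2" by simp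
  also have "\<dots> = (1 - ?\<alpha>) * ((cmod c)\<^sup>2 / (1 - ?\<alpha>) + ?\<alpha> * (cmod w)\<^sup>2)"
    using assms by (simp add: field_simps)
  finally show ?thesis using assms by (simp add: mult_le_cancel_left_pos)
qed

text \<open>The second summand on the left makes the induction on the number of terms go through: one
  Horner step \<open>p(w) = x\<^sub>0 + w q(w)\<close> consumes the value of \<open>q\<close> at \<open>\<phi>(0)\<close> and produces that of \<open>p\<close>.\<close>

lemma littlewood_subordination:
  assumes \<phi>: "\<phi> holomorphic_on ball 0 1" "\<phi> ` ball 0 1 \<subseteq> ball 0 1" and r: "0 \<le> r" "r < 1"
  shows "(1 - cmod (\<phi> 0)) * circle_mean r (\<lambda>z. \<Sum>n<N. x n * \<phi> z ^ n)
      + cmod (\<phi> 0) * (cmod (\<Sum>n<N. x n * \<phi> 0 ^ n))\<^sup>2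
      \<le> (\<Sum>n<N. (cmod (x n))\<^sup>2) / (1 - cmod (\<phi> 0))"
proof (induction N arbitrary: x)
  case 0
  then show ?case by (simp add: circle_mean_def)
next
  case (Suc N)
  let ?\<alpha> = "cmod (\<phi> 0)"
  let ?q = "\<lambda>z. \<Sum>n<N. x (Suc n) * \<phi> z ^ n"
  have \<alpha>: "?\<alpha> < 1" using \<phi>(2) by (auto simp: image_subset_iff)
  have eq: "(\<Sum>n<Suc N. x n * \<phi> z ^ n) = x 0 + \<phi> z * ?q z" for z
    unfolding sum.lessThan_Suc_shift by (simp add: sum_distrib_left mult.left_commute)
  let ?p0 = "(cmod (x 0 + \<phi> 0 * ?q 0))\<^sup>2"
  have "circle_mean r (\<lambda>z. x 0 + \<phi> z * ?q z) \<le> ?p0 + circle_mean r ?q"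
    by (intro circle_mean_add_const_mult \<phi> r holomorphic_intros)
  then have "(1 - ?\<alpha>) * circle_mean r (\<lambda>z. x 0 + \<phi> z * ?q z) + ?\<alpha> * ?p0
      \<le> (1 - ?\<alpha>) * (?p0 + circle_mean r ?q) + ?\<alpha> * ?p0"
    using \<alpha> by (intro add_right_mono mult_left_mono) auto
  also have "\<dots> = ?p0 + (1 - ?\<alpha>) * circle_mean r ?q"
    by (simp add: algebra_simps)
  also have "\<dots> \<le> (cmod (x 0))\<^sup>2 / (1 - ?\<alpha>) + (?\<alpha> * (cmod (?q 0))\<^sup>2 + (1 - ?\<alpha>) * circle_mean r ?q)"
    using norm_add_mult_square_le[OF \<alpha>, of "x 0" "?q 0"] by simp
  also have "\<dots> \<le> (cmod (x 0))\<^sup>2 / (1 - ?\<alpha>) + (\<Sum>n<N. (cmod (x (Suc n)))\<^sup>2) / (1 - ?\<alpha>)"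
    using Suc.IH[of "\<lambda>n. x (Suc n)"] by simp
  finally show ?case
    unfolding eq sum.lessThan_Suc_shift[of "\<lambda>n. (cmod (x n))\<^sup>2"] add_divide_distrib .
qed

text \<open>The nonnegative second summand is dropped; the remaining bound is uniform in
  \<open>r\<close> and passes to the coefficients.\<close>

lemma littlewood_taylor:
  assumes \<phi>: "\<phi> holomorphic_on ball 0 1" "\<phi> ` ball 0 1 \<subseteq> ball 0 1"
    and p: "has_taylor (\<lambda>z. \<Sum>n<N. x n * \<phi> z ^ n) p"
  shows "(\<Sum>n<k. (cmod (p n))\<^sup>2) \<le> (\<Sum>n<N. (cmod (x n))\<^sup>2) / (1 - cmod (\<phi> 0))\<^sup>2"
proof (rule taylor_sum_le_of_circle_means[OF p])
  fix r :: real assume r: "0 < r" "r < 1"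
  let ?M = "circle_mean r (\<lambda>z. \<Sum>n<N. x n * \<phi> z ^ n)"
  have \<alpha>: "cmod (\<phi> 0) < 1" using \<phi>(2) by (auto simp: image_subset_iff)
  have "0 \<le> cmod (\<phi> 0) * (cmod (\<Sum>n<N. x n * \<phi> 0 ^ n))\<^sup>2" by simp
  then have "(1 - cmod (\<phi> 0)) * ?M \<le> (\<Sum>n<N. (cmod (x n))\<^sup>2) / (1 - cmod (\<phi> 0))"
    using littlewood_subordination[OF \<phi>, of r x N] r by linarith
  then have "?M * (1 - cmod (\<phi> 0))\<^sup>2 \<le> (\<Sum>n<N. (cmod (x n))\<^sup>2)"
    using \<alpha> by (simp add: pos_le_divide_eq power2_eq_square mult_ac)
  then show "?M \<le> (\<Sum>n<N. (cmod (x n))\<^sup>2) / (1 - cmod (\<phi> 0))\<^sup>2"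
    using \<alpha> by (simp add: pos_le_divide_eq)
qed

section \<open>The condition is sufficient\<close>

lemma geometric_lower_bound:
  fixes \<beta> :: "nat \<Rightarrow> real"
  assumes pos: "\<And>n. \<beta> n > 0" and growth: "liminf (\<lambda>n. ereal (root n (\<beta> n))) \<ge> 1"
    and s: "0 < s" "s < 1"
  obtains c where "c > 0" "\<And>n. c * s ^ n \<le> \<beta> n"
proof -
  have "ereal s < 1" using s by simp
  then have "eventually (\<lambda>n. ereal s < ereal (root n (\<beta> n))) sequentially"
    using growth unfolding le_Liminf_iff by blast
  then obtain n0 where n0: "\<And>n. n \<ge> n0 \<Longrightarrow> s < root n (\<beta> n)"
    by (auto simp: eventually_sequentially)
  \<comment> \<open>Starting at \<open>Suc n0\<close> excludes \<open>n = 0\<close>, where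
    \<open>root 0\<close> is 0 and its zeroth power does not recover
    \<open>\<beta> 0\<close>.\<close>
  have big: "s ^ n \<le> \<beta> n" if "n \<ge> Suc n0" for n
  proof -
    have "s ^ n \<le> root n (\<beta> n) ^ n" using n0[of n] that s by (intro power_mono) auto
    then show ?thesis using that pos[of n] by simp
  qed
  \<comment> \<open>The initial ratios handle \<open>n \<le> n0\<close>; the extra 1 caps
    \<open>c\<close> so that the same constant serves beyond \<open>n0\<close>.\<close>
  define c where "c = Min (insert 1 ((\<lambda>n. \<beta> n / s ^ n) ` {..n0}))"
  show ?thesis
  proof
    show "c > 0" unfolding c_def using pos s by (subst Min_gr_iff) auto
    fix n
    show "c * s ^ n \<le> \<beta> n"
    proof (cases "n \<le> n0")
      case True
      then have "c \<le> \<beta> n / s ^ n" unfolding c_def by (intro Min_le) auto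
      then show ?thesis using s by (simp add: pos_le_divide_eq)
    next
      case False
      have "c \<le> 1" unfolding c_def by (intro Min_le) auto
      then have "c * s ^ n \<le> 1 * s ^ n" using s by (intro mult_right_mono) auto
      then show ?thesis using big[of n] False by simp
    qed
  qed
qed

lemma coeff_geometric_bound:
  fixes \<beta> :: "nat \<Rightarrow> real" and a :: "nat \<Rightarrow> complex"
  assumes pos: "\<And>n. \<beta> n > 0" and growth: "liminf (\<lambda>n. ereal (root n (\<beta> n))) \<ge> 1"
    and a: "summable (\<lambda>n. (cmod (a n))\<^sup>2 * \<beta> n)" and s: "0 < s" "s < 1"
  obtains A where "A \<ge> 0" "\<And>n. cmod (a n) * s ^ n \<le> A"
proof -
  have s2: "0 < s\<^sup>2" "s\<^sup>2 < 1" using s by (auto simp: power_less_one_iff)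
  \<comment> \<open>The rate is \<open>s\<^sup>2\<close> because the coefficients enter the norm
    squared.\<close>
  obtain c where c: "c > 0" "\<And>n. c * (s\<^sup>2) ^ n \<le> \<beta> n"
    using geometric_lower_bound[OF pos growth s2] by blast
  define F where "F = (\<Sum>n. (cmod (a n))\<^sup>2 * \<beta> n)"
  have nn: "0 \<le> (cmod (a n))\<^sup>2 * \<beta> n" for n using pos[of n] by simp
  have "cmod (a n) * s ^ n \<le> sqrt (F / c)" for n
  proof (rule real_le_rsqrt)
    have "(cmod (a n) * s ^ n)\<^sup>2 * c = (cmod (a n))\<^sup>2 * (c * (s\<^sup>2) ^ n)"
      by (simp add: power_mult_distrib power_commutes flip: power_mult) (simp add: mult_ac)
    also have "\<dots> \<le> (cmod (a n))\<^sup>2 * \<beta> n" using c by (intro mult_left_mono) auto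
    also have "\<dots> \<le> F" unfolding F_def
      using sum_le_suminf[OF a, of "{n}"] nn by simp
    finally show "(cmod (a n) * s ^ n)\<^sup>2 \<le> F / c" using c by (simp add: pos_le_divide_eq)
  qed
  moreover have "0 \<le> F" unfolding F_def by (rule suminf_nonneg[OF a nn])
  ultimately show ?thesis using that[of "sqrt (F / c)"] c by simp
qed

text \<open>At a radius \<open>s\<close> strictly between \<open>cmod z\<close> and 1 the
  coefficient bound gives geometric domination. This later yields the function with prescribed
  lacunary coefficients.\<close>

lemma H2_power_series:
  fixes \<beta> :: "nat \<Rightarrow> real" and a :: "nat \<Rightarrow> complex"
  assumes pos: "\<And>n. \<beta> n > 0" and growth: "liminf (\<lambda>n. ereal (root n (\<beta> n))) \<ge> 1"
    and a: "summable (\<lambda>n. (cmod (a n))\<^sup>2 * \<beta> n)"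
  shows "has_taylor (\<lambda>z. \<Sum>n. a n * z ^ n) a"
  unfolding has_taylor_def
proof
  fix z :: complex assume z: "z \<in> ball 0 1"
  define s where "s = (1 + cmod z) / 2"
  have s: "0 < s" "s < 1" "cmod z < s" using z by (auto simp: s_def add_pos_nonneg)
  obtain A where A: "\<And>n. cmod (a n) * s ^ n \<le> A"
    using coeff_geometric_bound[OF pos growth a s(1,2)] by blast
  have "summable (\<lambda>n. A * (cmod z / s) ^ n)"
    using s by (intro summable_mult summable_geometric) simp
  moreover have "norm (a n * z ^ n) \<le> A * (cmod z / s) ^ n" for n
  proof -
    have "norm (a n * z ^ n) = (cmod (a n) * s ^ n) * (cmod z / s) ^ n"
      using s by (simp add: norm_mult norm_power power_divide)
    also have "\<dots> \<le> A * (cmod z / s) ^ n" using A s by (intro mult_right_mono) auto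
    finally show ?thesis .
  qed
  ultimately have "summable (\<lambda>n. a n * z ^ n)"
    by (rule summable_comparison_test'[where N = 0])
  then show "(\<lambda>n. a n * z ^ n) sums (\<Sum>n. a n * z ^ n)" by (rule summable_sums)
qed

text \<open>The maximum over the compact half disc is below 1. Writing the bound as a square offers
  two factors \<open>s\<close>: one absorbs the growth of the coefficients, the other gives
  decay.\<close>

lemma sup_norm_on_half_disc:
  assumes "\<phi> holomorphic_on ball 0 1" "\<phi> ` ball 0 1 \<subseteq> ball 0 1"
  obtains s where "0 < s" "s < 1" "\<And>z. cmod z = 1/2 \<Longrightarrow> cmod (\<phi> z) \<le> s\<^sup>2"
proof -
  have "continuous_on (cball 0 (1/2)) (\<lambda>z. cmod (\<phi> z))"
    by (intro continuous_intros holomorphic_on_imp_continuous_on holomorphic_on_subset[OF assms(1)]) auto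
  then obtain w where w: "w \<in> cball 0 (1/2)" "\<And>z. z \<in> cball 0 (1/2) \<Longrightarrow> cmod (\<phi> z) \<le> cmod (\<phi> w)"
    using continuous_attains_sup[of "cball 0 (1/2)" "\<lambda>z. cmod (\<phi> z)"] by auto
  \<comment> \<open>The lower bound 1/2 keeps \<open>s\<close> positive even if
    \<open>\<phi>\<close> vanishes on the half disc.\<close>
  define \<rho> where "\<rho> = max (cmod (\<phi> w)) (1/2)"
  have "w \<in> ball 0 1" using w(1) by simp
  then have "\<rho> < 1" using assms(2) unfolding \<rho>_def by (auto simp: image_subset_iff)
  moreover have "0 < \<rho>" unfolding \<rho>_def by simp
  moreover have "cmod (\<phi> z) \<le> \<rho>" if "cmod z = 1/2" for z
    using w(2)[of z] that unfolding \<rho>_def by simp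
  ultimately show ?thesis using that[of "sqrt \<rho>"] by simp
qed

text \<open>On the circle of radius 1/2 the remainder is at most \<open>B * (1/2) ^ k\<close>, which
  offsets the factor \<open>4 ^ k\<close> lost in reading off the first coefficients. Here
  \<open>j\<close> is chosen before \<open>f\<close>, and \<open>A\<close> is independent of
  \<open>k\<close> and \<open>N\<close>.\<close>

lemma composition_tail_bound:
  fixes \<beta> :: "nat \<Rightarrow> real"
  assumes pos: "\<And>n. \<beta> n > 0" and growth: "liminf (\<lambda>n. ereal (root n (\<beta> n))) \<ge> 1"
    and \<phi>: "\<phi> holomorphic_on ball 0 1" "\<phi> ` ball 0 1 \<subseteq> ball 0 1"
  shows "\<exists>j. \<forall>f a. has_taylor f a \<longrightarrow> summable (\<lambda>n. (cmod (a n))\<^sup>2 * \<beta> n) \<longrightarrow>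
    (\<exists>A. \<forall>k N b p. 2 ^ j * k \<le> N \<longrightarrow> has_taylor (f \<circ> \<phi>) b \<longrightarrow> has_taylor (\<lambda>z. \<Sum>n<N. a n * \<phi> z ^ n) p \<longrightarrow>
      (\<Sum>m\<le>k. (cmod (b m - p m))\<^sup>2) \<le> A)"
proof -
  obtain s where s: "0 < s" "s < 1" "\<And>z. cmod z = 1/2 \<Longrightarrow> cmod (\<phi> z) \<le> s\<^sup>2"
    using sup_norm_on_half_disc[OF \<phi>] by blast
  \<comment> \<open>As \<open>j \<le> 2 ^ j\<close>, the dilation factor may be enlarged to a power
    of two, the form that iterating \<open>Delta2\<close> can handle.\<close>
  obtain j where "s ^ j < 1/2" using real_arch_pow_inv[of "1/2" s] s by auto
  moreover have "s ^ 2 ^ j \<le> s ^ j" using s by (intro power_decreasing) auto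
  ultimately have j: "s ^ 2 ^ j \<le> 1/2" by linarith
  show ?thesis
  proof (intro exI[of _ j] allI impI)
    fix f a
    assume f: "has_taylor f a" and a: "summable (\<lambda>n. (cmod (a n))\<^sup>2 * \<beta> n)"
    obtain A where A: "A \<ge> 0" "\<And>n. cmod (a n) * s ^ n \<le> A"
      using coeff_geometric_bound[OF pos growth a s(1,2)] by blast
    define B where "B = A / (1 - s)"
    have B: "B \<ge> 0" using A s by (simp add: B_def)
    have "(\<Sum>m\<le>k. (cmod (b m - p m))\<^sup>2) \<le> 4 * B\<^sup>2"
      if N: "2 ^ j * k \<le> N" and b: "has_taylor (f \<circ> \<phi>) b" and p: "has_taylor (\<lambda>z. \<Sum>n<N. a n * \<phi> z ^ n) p"
      for k N b p
    proof -
      let ?R = "\<lambda>z. (f \<circ> \<phi>) z - (\<Sum>n<N. a n * \<phi> z ^ n)"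
      have R: "has_taylor ?R (\<lambda>m. b m - p m)" by (rule has_taylor_diff[OF b p])
      have bound: "cmod (?R z) \<le> B * (1/2) ^ k" if z: "cmod z = 1/2" for z
      proof -
        let ?w = "\<phi> z"
        have w: "cmod ?w \<le> s\<^sup>2" by (rule s(3)[OF z])
        have "?w \<in> ball 0 1" using \<phi>(2) z by (auto simp: image_subset_iff)
        then have "(\<lambda>n. a n * ?w ^ n) sums f ?w" using f unfolding has_taylor_def by blast
        then have tail: "(\<lambda>n. a (n + N) * ?w ^ (n + N)) sums ?R z"
          using sums_iff_shift[of "\<lambda>n. a n * ?w ^ n" N "?R z"] by simp
        have geo: "(\<lambda>n. A * s ^ N * s ^ n) sums (A * s ^ N * (1 / (1 - s)))"
          using s by (intro sums_mult geometric_sums) simp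
        have le: "norm (a (n + N) * ?w ^ (n + N)) \<le> A * s ^ N * s ^ n" for n
        proof -
          have "norm (a (n + N) * ?w ^ (n + N)) \<le> cmod (a (n + N)) * (s\<^sup>2) ^ (n + N)"
            unfolding norm_mult norm_power using w by (intro mult_left_mono power_mono) auto
          also have "\<dots> = (cmod (a (n + N)) * s ^ (n + N)) * s ^ (n + N)"
            by (simp add: power2_eq_square power_mult_distrib)
          also have "\<dots> \<le> A * s ^ (n + N)"
            using A s by (intro mult_right_mono) auto
          finally show ?thesis by (simp add: power_add mult_ac)
        qed
        have "cmod (?R z) \<le> (\<Sum>n. A * s ^ N * s ^ n)"
          using norm_suminf_le[OF le sums_summable[OF geo]] sums_unique[OF tail] by simp
        also have "\<dots> = B * s ^ N" using sums_unique[OF geo] by (simp add: B_def)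
        also have "\<dots> \<le> B * (1/2) ^ k"
        proof (intro mult_left_mono B)
          have "s ^ N \<le> s ^ (2 ^ j * k)" using N s by (intro power_decreasing) auto
          also have "\<dots> \<le> (1/2) ^ k" unfolding power_mult using j s by (intro power_mono) auto
          finally show "s ^ N \<le> (1/2) ^ k" .
        qed
        finally show ?thesis .
      qed
      have "circle_mean (1/2) ?R \<le> (B * (1/2) ^ k)\<^sup>2"
        by (rule circle_mean_le[OF has_taylor_holomorphic[OF R]]) (use bound in auto)
      then have "circle_mean (1/2) ?R / (1/2) ^ (2 * Suc k) \<le> (B * (1/2) ^ k)\<^sup>2 / (1/2) ^ (2 * Suc k)"
        by (intro divide_right_mono) auto
      \<comment> \<open>The factor 4 remains because the coefficients up to and including index
        \<open>k\<close> are counted.\<close>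
      also have "\<dots> = 4 * B\<^sup>2"
        by (simp add: power_mult_distrib power_mult field_simps power2_eq_square)
      finally show ?thesis
        using taylor_partial_sum_le[OF R, of "1/2" "Suc k"] by (simp add: lessThan_Suc_atMost)
    qed
    then show "\<exists>A. \<forall>k N b p. 2 ^ j * k \<le> N \<longrightarrow> has_taylor (f \<circ> \<phi>) b \<longrightarrow>
        has_taylor (\<lambda>z. \<Sum>n<N. a n * \<phi> z ^ n) p \<longrightarrow> (\<Sum>m\<le>k. (cmod (b m - p m))\<^sup>2) \<le> A"
      by blast
  qed
qed

section \<open>Summation by parts and sufficiency\<close>

lemma weighted_sum_le_of_partial_sums:
  fixes x y w :: "nat \<Rightarrow> real"
  assumes y: "\<And>n. y n \<ge> 0" and w: "antimono w" "\<And>n. w n \<ge> 0"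
    and dil: "\<And>m. w m \<le> D * w (M * m)" and D: "D \<ge> 0"
    and le: "\<And>k. (\<Sum>m\<le>k. x m) \<le> c + (\<Sum>n\<le>M * k. y n)"
  shows "(\<Sum>m\<le>k. x m * w m) \<le> c * w 0 + D * (\<Sum>n\<le>M * k. y n * w n)"
proof -
  \<comment> \<open>\<open>W k\<close> is the slack in the hypothesis at \<open>k\<close>. Carrying
    \<open>w k * W k\<close> on the left turns the induction into a summation by parts; it is
    discarded at the end.\<close>
  define W where "W k = c + (\<Sum>n\<le>M * k. y n) - (\<Sum>m\<le>k. x m)" for k
  have W: "W k \<ge> 0" for k using le[of k] by (simp add: W_def)
  have "(\<Sum>m\<le>k. x m * w m) + w k * W k \<le> c * w 0 + D * (\<Sum>n\<le>M * k. y n * w n)"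
  proof (induction k)
    case 0
    have "w 0 * y 0 \<le> (D * w 0) * y 0" using dil[of 0] y by (intro mult_right_mono) auto
    then show ?case by (simp add: W_def algebra_simps)
  next
    case (Suc k)
    let ?blk = "{M * k<..M * Suc k}"
    have split: "{..M * Suc k} = {..M * k} \<union> ?blk" by auto
    have sp: "(\<Sum>n\<le>M * Suc k. g n) = (\<Sum>n\<le>M * k. g n) + (\<Sum>n\<in>?blk. g n)" for g :: "nat \<Rightarrow> real"
      unfolding split by (rule sum.union_disjoint) auto
    have WS: "W (Suc k) = W k + (\<Sum>n\<in>?blk. y n) - x (Suc k)"
      unfolding W_def sp by simp
    \<comment> \<open>Indices in the new block are at most \<open>M * Suc k\<close>, so dilation and
      monotonicity give \<open>w (Suc k) \<le> D * w n\<close>.\<close>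
    have "w (Suc k) * (\<Sum>n\<in>?blk. y n) \<le> (\<Sum>n\<in>?blk. D * (y n * w n))"
      unfolding sum_distrib_left
    proof (rule sum_mono)
      fix n assume n: "n \<in> ?blk"
      have "w (Suc k) \<le> D * w (M * Suc k)" by (rule dil)
      also have "w (M * Suc k) \<le> w n" by (rule antimonoD[OF w(1)]) (use n in simp)
      finally have "w (Suc k) * y n \<le> D * w n * y n" using D y by (simp add: mult_left_mono mult_right_mono)
      then show "w (Suc k) * y n \<le> D * (y n * w n)" by (simp add: mult_ac)
    qed
    moreover have "w (Suc k) * W k \<le> w k * W k"
      by (intro mult_right_mono W antimonoD[OF w(1)]) simp
    ultimately show ?case using Suc.IH unfolding WS sp
      by (simp add: algebra_simps sum_distrib_left)
  qed
  moreover have "0 \<le> w k * W k" using w(2) W by simp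
  ultimately show ?thesis by linarith
qed

text \<open>Summation by parts needs a truly decreasing weight; the supremum of
  \<open>\<beta>\<close> over tails is one, and it is comparable with
  \<open>\<beta>\<close>.\<close>

lemma ess_decreasing_equivalent_antimono:
  fixes \<beta> :: "nat \<Rightarrow> real"
  assumes "ess_decreasing \<beta>"
  obtains w C where "C \<ge> 1" "antimono w" "\<And>n. \<beta> n \<le> w n" "\<And>n. w n \<le> C * \<beta> n"
proof -
  obtain C where C: "C \<ge> 1" "\<And>m n. n \<le> m \<Longrightarrow> \<beta> m \<le> C * \<beta> n"
    using assms unfolding ess_decreasing_def by blast
  define w where "w n = (SUP m\<in>{n..}. \<beta> m)" for n
  have bdd: "bdd_above (\<beta> ` {n..})" for n using C(2)[of n] by (auto intro!: bdd_aboveI[where M = "C * \<beta> n"])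
  show ?thesis
  proof (rule that[OF C(1)])
    show "antimono w" unfolding w_def by (intro antimonoI cSUP_subset_mono bdd) auto
    show "\<beta> n \<le> w n" for n unfolding w_def by (intro cSUP_upper bdd) auto
    show "w n \<le> C * \<beta> n" for n unfolding w_def by (intro cSUP_least C(2)) auto
  qed
qed

lemma Delta2_iterate:
  fixes \<beta> :: "nat \<Rightarrow> real"
  assumes d: "\<And>n. \<delta> * \<beta> n \<le> \<beta> (2 * n)" "0 < \<delta>"
  shows "\<delta> ^ j * \<beta> n \<le> \<beta> (2 ^ j * n)"
proof (induction j)
  case (Suc j)
  have "\<delta> * (\<delta> ^ j * \<beta> n) \<le> \<delta> * \<beta> (2 ^ j * n)" using Suc d by (intro mult_left_mono) auto
  also have "\<dots> \<le> \<beta> (2 * (2 ^ j * n))" by (rule d)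
  finally show ?case by (simp add: mult.assoc)
qed simp

lemma weighted_sum_square_triangle:
  fixes b p :: "nat \<Rightarrow> complex" and w :: "nat \<Rightarrow> real"
  assumes w: "\<And>m. w m \<ge> 0"
  shows "(\<Sum>m\<in>I. (cmod (b m))\<^sup>2 * w m)
    \<le> 2 * (\<Sum>m\<in>I. (cmod (b m - p m))\<^sup>2 * w m) + 2 * (\<Sum>m\<in>I. (cmod (p m))\<^sup>2 * w m)"
proof -
  have "(cmod (b m))\<^sup>2 * w m \<le> 2 * ((cmod (b m - p m))\<^sup>2 * w m) + 2 * ((cmod (p m))\<^sup>2 * w m)" for m
  proof -
    have "cmod (b m) \<le> cmod (b m - p m) + cmod (p m)"
      using norm_triangle_ineq[of "b m - p m" "p m"] by simp
    then have "(cmod (b m))\<^sup>2 \<le> (cmod (b m - p m) + cmod (p m))\<^sup>2" by (intro power_mono) auto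
    then have "(cmod (b m))\<^sup>2 \<le> 2 * (cmod (b m - p m))\<^sup>2 + 2 * (cmod (p m))\<^sup>2"
      using sum_squares_bound[of "cmod (b m - p m)" "cmod (p m)"] by (simp add: power2_sum)
    from mult_right_mono[OF this w[of m]] show ?thesis by (simp add: algebra_simps)
  qed
  then show ?thesis unfolding sum_distrib_left sum.distrib[symmetric] by (intro sum_mono)
qed

lemma Delta2_imp_comp_bounded:
  fixes \<beta> :: "nat \<Rightarrow> real"
  assumes pos: "\<And>n. \<beta> n > 0" and dec: "ess_decreasing \<beta>"
    and growth: "liminf (\<lambda>n. ereal (root n (\<beta> n))) \<ge> 1"
    and D2: "Delta2 \<beta>"
    and \<phi>: "\<phi> holomorphic_on ball 0 1" "\<phi> ` ball 0 1 \<subseteq> ball 0 1"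
  shows "comp_bounded \<beta> \<phi>"
  unfolding comp_bounded_def
proof (intro allI impI)
  fix f assume "in_H2 \<beta> f"
  then obtain a where f: "has_taylor f a" and a: "summable (\<lambda>n. (cmod (a n))\<^sup>2 * \<beta> n)"
    unfolding in_H2_def has_taylor_def by blast
  have hol: "(f \<circ> \<phi>) holomorphic_on ball 0 1"
    by (rule holomorphic_on_compose_gen[OF \<phi>(1) has_taylor_holomorphic[OF f] \<phi>(2)])
  then obtain b where b: "has_taylor (f \<circ> \<phi>) b" by (rule holomorphic_has_taylor)
  obtain j where "\<forall>f a. has_taylor f a \<longrightarrow> summable (\<lambda>n. (cmod (a n))\<^sup>2 * \<beta> n) \<longrightarrow>
      (\<exists>A. \<forall>k N b p. 2 ^ j * k \<le> N \<longrightarrow> has_taylor (f \<circ> \<phi>) b \<longrightarrow>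
        has_taylor (\<lambda>z. \<Sum>n<N. a n * \<phi> z ^ n) p \<longrightarrow> (\<Sum>m\<le>k. (cmod (b m - p m))\<^sup>2) \<le> A)"
    using composition_tail_bound[OF pos growth \<phi>] by blast
  from this[rule_format, OF f a] obtain A where A: "\<And>k N b p. 2 ^ j * k \<le> N \<Longrightarrow> has_taylor (f \<circ> \<phi>) b \<Longrightarrow>
      has_taylor (\<lambda>z. \<Sum>n<N. a n * \<phi> z ^ n) p \<Longrightarrow> (\<Sum>m\<le>k. (cmod (b m - p m))\<^sup>2) \<le> A"
    by blast
  \<comment> \<open>The 2 comes from the squared triangle inequality, the denominator from
    Littlewood's principle.\<close>
  define L where "L = 2 / (1 - cmod (\<phi> 0))\<^sup>2"
  have L: "L \<ge> 0" by (simp add: L_def)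
  have part: "(\<Sum>m\<le>k. (cmod (b m))\<^sup>2) \<le> 2 * A + (\<Sum>n\<le>2 ^ j * k. L * (cmod (a n))\<^sup>2)" for k
  proof -
    let ?N = "Suc (2 ^ j * k)"
    have "(\<lambda>z. \<Sum>n<?N. a n * \<phi> z ^ n) holomorphic_on ball 0 1"
      by (intro holomorphic_intros \<phi>)
    then obtain p where p: "has_taylor (\<lambda>z. \<Sum>n<?N. a n * \<phi> z ^ n) p" by (rule holomorphic_has_taylor)
    have "(\<Sum>m\<le>k. (cmod (b m - p m))\<^sup>2) \<le> A" by (rule A[OF _ b p]) simp
    moreover have "2 * (\<Sum>m\<le>k. (cmod (p m))\<^sup>2) \<le> (\<Sum>n\<le>2 ^ j * k. L * (cmod (a n))\<^sup>2)"
      using littlewood_taylor[OF \<phi> p, of "Suc k"]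
      by (simp only: L_def lessThan_Suc_atMost flip: sum_distrib_left) simp
    ultimately show ?thesis using weighted_sum_square_triangle[of "\<lambda>_. 1" b "{..k}" p] by simp
  qed
  obtain w C where w: "C \<ge> 1" "antimono w" "\<And>n. \<beta> n \<le> w n" "\<And>n. w n \<le> C * \<beta> n"
    by (rule ess_decreasing_equivalent_antimono[OF dec], rule that)
  have w0: "w n \<ge> 0" for n using w(3)[of n] pos[of n] by linarith
  obtain \<delta> where \<delta>: "0 < \<delta>" "\<And>n. \<delta> * \<beta> n \<le> \<beta> (2 * n)"
    using D2 by (auto simp: Delta2_def)
  define D where "D = C / \<delta> ^ j"
  have D: "D \<ge> 0" using w(1) \<delta> by (simp add: D_def)
  \<comment> \<open>The \<open>j\<close> doublings cost \<open>\<delta> ^ j\<close>, and replacing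
    \<open>w\<close> by \<open>\<beta>\<close> costs \<open>C\<close>.\<close>
  have dil: "w m \<le> D * w (2 ^ j * m)" for m
  proof -
    have "\<delta> ^ j * w m \<le> \<delta> ^ j * (C * \<beta> m)" using w(4) \<delta> by (intro mult_left_mono) auto
    also have "\<dots> = C * (\<delta> ^ j * \<beta> m)" by simp
    also have "\<dots> \<le> C * w (2 ^ j * m)"
      using w(1) order.trans[OF Delta2_iterate[of \<delta> \<beta>, OF \<delta>(2,1)] w(3)] by (intro mult_left_mono) auto
    finally show ?thesis using \<delta> by (simp add: D_def field_simps)
  qed
  define F where "F = (\<Sum>n. (cmod (a n))\<^sup>2 * \<beta> n)"
  have "(\<Sum>m\<le>k. (cmod (b m))\<^sup>2 * \<beta> m) \<le> 2 * A * w 0 + D * (L * C * F)" for k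
  proof -
    have "(\<Sum>n\<le>2 ^ j * k. L * (cmod (a n))\<^sup>2 * w n) \<le> (\<Sum>n\<le>2 ^ j * k. L * C * ((cmod (a n))\<^sup>2 * \<beta> n))"
    proof (rule sum_mono)
      fix n
      have "(L * (cmod (a n))\<^sup>2) * w n \<le> (L * (cmod (a n))\<^sup>2) * (C * \<beta> n)"
        using w(4) L by (intro mult_left_mono) auto
      then show "L * (cmod (a n))\<^sup>2 * w n \<le> L * C * ((cmod (a n))\<^sup>2 * \<beta> n)" by (simp add: mult_ac)
    qed
    also have "\<dots> = L * C * (\<Sum>n\<le>2 ^ j * k. (cmod (a n))\<^sup>2 * \<beta> n)" by (simp add: sum_distrib_left)
    also have "\<dots> \<le> L * C * F"
      unfolding F_def using L w(1) pos by (intro mult_left_mono sum_le_suminf a) (auto simp: less_imp_le)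
    finally have "D * (\<Sum>n\<le>2 ^ j * k. L * (cmod (a n))\<^sup>2 * w n) \<le> D * (L * C * F)"
      using D by (rule mult_left_mono)
    moreover have "(\<Sum>m\<le>k. (cmod (b m))\<^sup>2 * w m) \<le> 2 * A * w 0 + D * (\<Sum>n\<le>2 ^ j * k. L * (cmod (a n))\<^sup>2 * w n)"
      by (rule weighted_sum_le_of_partial_sums[OF _ w(2) w0 dil D part]) (use L in simp)
    moreover have "(\<Sum>m\<le>k. (cmod (b m))\<^sup>2 * \<beta> m) \<le> (\<Sum>m\<le>k. (cmod (b m))\<^sup>2 * w m)"
      using w(3) by (intro sum_mono mult_left_mono) auto
    ultimately show ?thesis by linarith
  qed
  then have "summable (\<lambda>m. (cmod (b m))\<^sup>2 * \<beta> m)"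
    using pos by (intro bounded_imp_summable) (auto simp: less_imp_le)
  then show "in_H2 \<beta> (f \<circ> \<phi>)"
    using hol b unfolding in_H2_def has_taylor_def by blast
qed

section \<open>The condition is necessary\<close>

lemma T_real_properties:
  fixes a :: real
  assumes a: "0 < a" "a < 1"
  shows T_holomorphic: "T (of_real a) holomorphic_on ball 0 1"
    and T_norm_square: "\<And>z. z \<in> ball 0 1 \<Longrightarrow>
      (cmod (T (of_real a) z))\<^sup>2 = 1 - (1 - (cmod z)\<^sup>2) * (1 - a\<^sup>2) / (cmod (1 + of_real a * z))\<^sup>2"
    and T_maps_disc: "T (of_real a) ` ball 0 1 \<subseteq> ball 0 1"
    and T_symbol: "symbol (T (of_real a))"
proof -
  have nz: "1 + of_real a * z \<noteq> 0" if "z \<in> ball 0 1" for z :: complex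
  proof
    assume "1 + of_real a * z = 0"
    then have "of_real a * z = -1" by (simp add: eq_neg_iff_add_eq_0 add.commute)
    then have "a * cmod z = 1" using a by (metis norm_minus_cancel norm_mult norm_of_real norm_one abs_of_pos)
    moreover have "a * cmod z < 1 * 1" using a that by (intro mult_strict_mono) auto
    ultimately show False by simp
  qed
  show hol: "T (of_real a) holomorphic_on ball 0 1"
    unfolding T_def using nz by (intro holomorphic_intros) auto
  show sq: "(cmod (T (of_real a) z))\<^sup>2 = 1 - (1 - (cmod z)\<^sup>2) * (1 - a\<^sup>2) / (cmod (1 + of_real a * z))\<^sup>2"
    if z: "z \<in> ball 0 1" for z :: complex
  proof -
    have "(cmod (of_real a + z))\<^sup>2 = (cmod (1 + of_real a * z))\<^sup>2 - (1 - (cmod z)\<^sup>2) * (1 - a\<^sup>2)"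
      unfolding cmod_power2 by (simp add: power2_eq_square algebra_simps)
    then show ?thesis using nz[OF z] unfolding T_def
      by (simp add: norm_divide power_divide diff_divide_distrib)
  qed
  show maps: "T (of_real a) ` ball 0 1 \<subseteq> ball 0 1"
  proof clarify
    fix z :: complex assume z: "z \<in> ball 0 1"
    have "(cmod z)\<^sup>2 < 1" "a\<^sup>2 < 1" using z a by (auto simp: power_less_one_iff abs_square_less_1)
    then have "0 < (1 - (cmod z)\<^sup>2) * (1 - a\<^sup>2) / (cmod (1 + of_real a * z))\<^sup>2"
      using nz[OF z] by (intro divide_pos_pos mult_pos_pos) auto
    then have "(cmod (T (of_real a) z))\<^sup>2 < 1" unfolding sq[OF z] by simp
    then show "T (of_real a) z \<in> ball 0 1" by (simp add: abs_square_less_1)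
  qed
  have "T (of_real a) 0 \<noteq> T (of_real a) (- of_real a)" using a by (simp add: T_def)
  moreover have "(0 :: complex) \<in> ball 0 1" "- of_real a \<in> ball (0 :: complex) 1" using a by auto
  ultimately show "symbol (T (of_real a))" unfolding symbol_def using hol maps by metis
qed

lemma T_power_circle_mean_ge:
  fixes a :: real
  assumes a: "0 < a" "a < 1" and r: "0 \<le> r" "r < 1"
  shows "(1 - (1 - r\<^sup>2) * (1 - a\<^sup>2)) ^ n / 4 \<le> circle_mean r (\<lambda>z. T (of_real a) z ^ n)"
proof -
  let ?c = "1 - (1 - r\<^sup>2) * (1 - a\<^sup>2)"
  let ?g = "\<lambda>t. (cmod (T (of_real a) (of_real r * cis t) ^ n))\<^sup>2"
  have r2: "0 \<le> 1 - r\<^sup>2" "1 - r\<^sup>2 \<le> 1" and a2: "0 \<le> 1 - a\<^sup>2" "1 - a\<^sup>2 \<le> 1"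
    using r a by (auto simp: power_le_one)
  have hol: "(\<lambda>z. T (of_real a) z ^ n) holomorphic_on ball 0 1"
    by (intro holomorphic_intros T_holomorphic a)
  note int = circle_integrable[OF hol r]
  \<comment> \<open>On this arc the real part of the point is nonnegative, so the denominator in
    \<open>T_norm_square\<close> is at least 1. The arc is a quarter of the circle, whence the
    1/4.\<close>
  have ge: "?c ^ n \<le> ?g t" if t: "t \<in> {0..pi/2}" for t
  proof -
    let ?z = "of_real r * cis t"
    have z: "cmod ?z = r" using r by (simp add: norm_mult)
    have "0 \<le> cos t" using t by (intro cos_ge_zero) auto
    then have "1 \<le> Re (1 + of_real a * ?z)" using r a by simp
    then have "1 \<le> cmod (1 + of_real a * ?z)" using complex_Re_le_cmod order.trans by blast
    then have d: "1 \<le> (cmod (1 + of_real a * ?z))\<^sup>2" by (rule one_le_power)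
    have "(1 - r\<^sup>2) * (1 - a\<^sup>2) / (cmod (1 + of_real a * ?z))\<^sup>2 \<le> (1 - r\<^sup>2) * (1 - a\<^sup>2) / 1"
      using r2 a2 d by (intro divide_left_mono mult_nonneg_nonneg) auto
    then have "?c \<le> (cmod (T (of_real a) ?z))\<^sup>2"
      using T_norm_square[OF a, of ?z] r z by simp
    moreover have "0 \<le> ?c" using mult_mono[of "1 - r\<^sup>2" 1 "1 - a\<^sup>2" 1] r2 a2 by simp
    ultimately have "?c ^ n \<le> ((cmod (T (of_real a) ?z))\<^sup>2) ^ n" by (intro power_mono)
    then show ?thesis by (simp add: norm_power power_mult[symmetric] mult.commute)
  qed
  have "pi / 2 * ?c ^ n = integral {0..pi/2} (\<lambda>_. ?c ^ n)" by simp
  also have "\<dots> \<le> integral {0..pi/2} ?g" by (intro integral_le int ge) auto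
  also have "\<dots> \<le> integral {0..2*pi} ?g" by (intro integral_subset_le int) auto
  finally show ?thesis unfolding circle_mean_def by (simp add: field_simps)
qed

lemma self_map_power_taylor_sum_le_1:
  assumes \<phi>: "\<phi> ` ball 0 1 \<subseteq> ball 0 1" and b: "has_taylor (\<lambda>z. \<phi> z ^ n) b"
  shows "(\<Sum>m<k. (cmod (b m))\<^sup>2) \<le> 1"
proof -
  have "cmod (\<phi> z ^ n) \<le> 1" if "z \<in> ball 0 1" for z
  proof -
    have "cmod (\<phi> z) < 1" using \<phi> that by (auto simp: image_subset_iff)
    then show ?thesis unfolding norm_power by (intro power_le_one) auto
  qed
  from taylor_sum_le_of_bounded[OF b this, of k] show ?thesis by simp
qed

text \<open>Parseval's weights are at most 1 up to \<open>L\<close> and at most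
  \<open>r ^ (2 * Suc L)\<close> beyond, where the mass is at most 1.\<close>

lemma circle_mean_le_low_frequencies:
  assumes g: "has_taylor g b" and r: "0 \<le> r" "r < 1" and le: "\<And>k. (\<Sum>m<k. (cmod (b m))\<^sup>2) \<le> 1"
  shows "circle_mean r g \<le> (\<Sum>m\<le>L. (cmod (b m))\<^sup>2) + r ^ (2 * Suc L)"
proof -
  have P: "(\<lambda>m. (cmod (b m))\<^sup>2 * r ^ (2 * m)) sums circle_mean r g" by (rule parseval[OF g r])
  have "(\<Sum>m<k. (cmod (b m))\<^sup>2 * r ^ (2 * m)) \<le> (\<Sum>m\<le>L. (cmod (b m))\<^sup>2) + r ^ (2 * Suc L)" for k
  proof -
    have "(\<Sum>m<k. (cmod (b m))\<^sup>2 * r ^ (2 * m))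
        \<le> (\<Sum>m<k. (if m \<le> L then (cmod (b m))\<^sup>2 else 0) + (cmod (b m))\<^sup>2 * r ^ (2 * Suc L))"
    proof (rule sum_mono)
      fix m
      have "r ^ (2 * m) \<le> (if m \<le> L then 1 else 0) + r ^ (2 * Suc L)"
      proof (cases "m \<le> L")
        case True
        have "r ^ (2 * m) \<le> 1" using r by (intro power_le_one) auto
        moreover have "0 \<le> r ^ (2 * Suc L)" using r by simp
        ultimately show ?thesis using True by simp
      next
        case False
        then have "r ^ (2 * m) \<le> r ^ (2 * Suc L)" using r by (intro power_decreasing) auto
        then show ?thesis using False by simp
      qed
      from mult_left_mono[OF this, of "(cmod (b m))\<^sup>2"]
      show "(cmod (b m))\<^sup>2 * r ^ (2 * m)
        \<le> (if m \<le> L then (cmod (b m))\<^sup>2 else 0) + (cmod (b m))\<^sup>2 * r ^ (2 * Suc L)"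
        by (simp add: algebra_simps split: if_splits)
    qed
    also have "\<dots> = (\<Sum>m\<in>{..<k} \<inter> {..L}. (cmod (b m))\<^sup>2) + (\<Sum>m<k. (cmod (b m))\<^sup>2) * r ^ (2 * Suc L)"
      by (simp add: sum.distrib sum_distrib_right sum.inter_restrict)
    also have "\<dots> \<le> (\<Sum>m\<le>L. (cmod (b m))\<^sup>2) + 1 * r ^ (2 * Suc L)"
      using r by (intro add_mono sum_mono2 mult_right_mono le) auto
    finally show ?thesis by simp
  qed
  then show ?thesis using P unfolding sums_def by (intro LIMSEQ_le_const2) auto
qed

lemma T_power_low_frequency_mass:
  fixes a :: real
  assumes a: "0 < a" "a < 1"
  obtains \<kappa> n0 where "\<kappa> > 0"
    "\<And>n b. n \<ge> n0 \<Longrightarrow> has_taylor (\<lambda>z. T (of_real a) z ^ n) b \<Longrightarrow>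
      \<kappa> \<le> (\<Sum>m\<le>nat \<lfloor>(1 - a\<^sup>2 / 2) * real n\<rfloor>. (cmod (b m))\<^sup>2)"
proof -
  define c where "c = 1 - a\<^sup>2"
  \<comment> \<open>The midpoint of \<open>c\<close> and 1: exceeding \<open>c\<close> makes the
    high frequencies negligible for large \<open>s\<close>, and staying below 1 makes the index
    shrink.\<close>
  define l where "l = 1 - a\<^sup>2 / 2"
  \<comment> \<open>chosen so that \<open>exp (- s * l)\<close>, the contribution of the high frequencies, is half of \<open>exp (- s * c) / 8\<close>\<close>
  define s where "s = 2 * ln 16 / a\<^sup>2"
  have s: "s > 0" using a by (simp add: s_def)
  have l: "l > 0" using power_le_one[of a 2] a unfolding l_def by simp
  have "s * (l - c) = ln 16" using a by (simp add: s_def l_def c_def field_simps)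
  then have "exp (- s * l) = exp (- s * c) * exp (- ln 16)"
    unfolding exp_add[symmetric] by (simp add: algebra_simps)
  then have sl: "exp (- s * l) = exp (- s * c) / 16" by (simp add: exp_minus)
  have "(\<lambda>n. (1 + (- s * c) / real n) ^ n) \<longlonglongrightarrow> exp (- s * c)"
    by (rule tendsto_exp_limit_sequentially)
  \<comment> \<open>Half the limit is a lower bound for large \<open>n\<close>; with the 1/4 from
    the arc it becomes \<open>exp (- s * c) / 8\<close>.\<close>
  then have "eventually (\<lambda>n. exp (- s * c) / 2 < (1 + (- s * c) / real n) ^ n) sequentially"
    by (rule order_tendstoD(1)) simp
  then obtain n1 where n1: "\<And>n. n \<ge> n1 \<Longrightarrow> exp (- s * c) / 2 < (1 + (- s * c) / real n) ^ n"
    by (auto simp: eventually_sequentially)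
  show ?thesis
  \<comment> \<open>The second entry of the maximum forces \<open>s < real n\<close>, so that
    \<open>1 - s / real n\<close> is positive.\<close>
  proof (rule that[of "exp (- s * c) / 16" "max n1 (nat \<lceil>s\<rceil> + 1)"])
    fix n b
    assume n: "n \<ge> max n1 (nat \<lceil>s\<rceil> + 1)" and b: "has_taylor (\<lambda>z. T (of_real a) z ^ n) b"
    have sn: "s < real n" "0 < real n" using n s by linarith+
    define r where "r = sqrt (1 - s / real n)"
    define L where "L = nat \<lfloor>l * real n\<rfloor>"
    have r2: "r\<^sup>2 = 1 - s / real n" using sn by (simp add: r_def)
    have r: "0 \<le> r" "r < 1" using sn s by (auto simp: r_def)
    have "exp (- s * c) / 8 \<le> (1 - (1 - r\<^sup>2) * (1 - a\<^sup>2)) ^ n / 4"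
      using n1[of n] n by (simp add: r2 c_def)
    also have "\<dots> \<le> circle_mean r (\<lambda>z. T (of_real a) z ^ n)" by (rule T_power_circle_mean_ge[OF a r])
    also have "\<dots> \<le> (\<Sum>m\<le>L. (cmod (b m))\<^sup>2) + r ^ (2 * Suc L)"
      by (rule circle_mean_le_low_frequencies[OF b r self_map_power_taylor_sum_le_1[OF T_maps_disc[OF a] b]])
    finally have "exp (- s * c) / 8 \<le> (\<Sum>m\<le>L. (cmod (b m))\<^sup>2) + r ^ (2 * Suc L)" .
    moreover have "r ^ (2 * Suc L) \<le> exp (- s * c) / 16"
    proof -
      have "r\<^sup>2 \<le> exp (- s / real n)" using exp_ge_add_one_self[of "- s / real n"] by (simp add: r2)
      then have "r ^ (2 * Suc L) \<le> exp (- s / real n) ^ Suc L"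
        unfolding power_mult by (intro power_mono) auto
      also have "\<dots> = exp (- (s / real n * real (Suc L)))"
        unfolding exp_of_nat_mult[symmetric] by (simp add: mult.commute)
      also have "\<dots> \<le> exp (- s * l)"
      proof -
        \<comment> \<open>The successor compensates the rounding down in \<open>L\<close>.\<close>
        have "l * real n \<le> real (Suc L)" unfolding L_def using l by linarith
        then have "s / real n * (l * real n) \<le> s / real n * real (Suc L)"
          using s by (intro mult_left_mono) auto
        then show ?thesis using sn by simp
      qed
      finally show ?thesis using sl by simp
    qed
    ultimately show "exp (- s * c) / 16 \<le> (\<Sum>m\<le>nat \<lfloor>(1 - a\<^sup>2 / 2) * real n\<rfloor>. (cmod (b m))\<^sup>2)"
      unfolding L_def l_def by linarith
  qed simp
qed

section \<open>Gliding hump for the powers of a self-map\<close>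

lemma weighted_parallelogram:
  fixes u v :: "nat \<Rightarrow> complex" and w :: "nat \<Rightarrow> real"
  shows "(\<Sum>m\<in>I. (cmod (u m + v m))\<^sup>2 * w m) + (\<Sum>m\<in>I. (cmod (u m - v m))\<^sup>2 * w m)
    = 2 * (\<Sum>m\<in>I. (cmod (u m))\<^sup>2 * w m) + 2 * (\<Sum>m\<in>I. (cmod (v m))\<^sup>2 * w m)"
proof -
  have "(cmod (x + y))\<^sup>2 + (cmod (x - y))\<^sup>2 = 2 * (cmod x)\<^sup>2 + 2 * (cmod y)\<^sup>2" for x y
    unfolding cmod_power2 by (simp add: power2_eq_square algebra_simps)
  then have "(cmod (x + y))\<^sup>2 * k + (cmod (x - y))\<^sup>2 * k = 2 * ((cmod x)\<^sup>2 * k) + 2 * ((cmod y)\<^sup>2 * k)" for x y k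
    by (metis distrib_right mult.assoc)
  then show ?thesis unfolding sum_distrib_left sum.distrib[symmetric] by (intro sum.cong) auto
qed

text \<open>By the parallelogram law, whatever the earlier sum \<open>F\<close> is, adding or
  subtracting the new vector gives weighted norm at least that of the new vector; so signs can be
  chosen recursively.\<close>

lemma sign_choice:
  fixes v :: "nat \<Rightarrow> nat \<Rightarrow> complex" and w :: "nat \<Rightarrow> real" and N :: "nat \<Rightarrow> nat"
  assumes w: "\<And>m. w m \<ge> 0"
  obtains e :: "nat \<Rightarrow> complex" where "\<And>k. cmod (e k) = 1"
    "\<And>k. (\<Sum>m\<le>N k. (cmod (v k m))\<^sup>2 * w m) \<le> (\<Sum>m\<le>N k. (cmod (\<Sum>i\<le>k. e i * v i m))\<^sup>2 * w m)"
proof -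
  let ?Q = "\<lambda>k u. \<Sum>m\<le>N k. (cmod (u m))\<^sup>2 * w m"
  \<comment> \<open>The state pairs the current sign with the running sum; the clause for
    \<open>k = 0\<close> fixes the initial sum.\<close>
  let ?P = "\<lambda>k (s, F). cmod s = 1 \<and> ?Q k (v k) \<le> ?Q k F \<and> (k = 0 \<longrightarrow> F = (\<lambda>m. s * v 0 m))"
  let ?R = "\<lambda>k (s, F) (s', F'). F' = (\<lambda>m. F m + s' * v (Suc k) m)"
  have "\<exists>h. \<forall>k. ?P k (h k) \<and> ?R k (h k) (h (Suc k))"
  proof (rule dependent_nat_choice)
    show "\<exists>x. ?P 0 x" by (intro exI[of _ "(1, v 0)"]) auto
    fix x k
    assume "?P k x"
    obtain s F where x: "x = (s, F)" by (cases x)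
    let ?u = "v (Suc k)"
    have "0 \<le> ?Q (Suc k) F" using w by (intro sum_nonneg) auto
    then consider "?Q (Suc k) ?u \<le> ?Q (Suc k) (\<lambda>m. F m + ?u m)" | "?Q (Suc k) ?u \<le> ?Q (Suc k) (\<lambda>m. F m - ?u m)"
      using weighted_parallelogram[of F ?u w "{..N (Suc k)}"] by linarith
    then show "\<exists>y. ?P (Suc k) y \<and> ?R k x y"
    proof cases
      case 1
      then show ?thesis unfolding x by (intro exI[of _ "(1, \<lambda>m. F m + ?u m)"]) auto
    next
      case 2
      then show ?thesis unfolding x by (intro exI[of _ "(-1, \<lambda>m. F m - ?u m)"]) auto
    qed
  qed
  then obtain h where Ph: "\<forall>k. ?P k (h k) \<and> ?R k (h k) (h (Suc k))" by (rule exE)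
  note h = Ph[THEN spec, THEN conjunct1] Ph[THEN spec, THEN conjunct2]
  have F: "snd (h k) = (\<lambda>m. \<Sum>i\<le>k. fst (h i) * v i m)" for k
  proof (induction k)
    case 0
    show ?case using h(1)[of 0] by (simp add: case_prod_beta)
  next
    case (Suc k)
    show ?case using h(2)[of k] Suc by (simp add: case_prod_beta)
  qed
  show ?thesis
    by (rule that[of "fst \<circ> h"]) (use h(1) F in \<open>simp_all add: case_prod_beta\<close>)
qed

text \<open>A gliding hump argument replaces the closed graph theorem: a failure of the uniform bound
  yields a lacunary series whose composition with \<^term>\<open>\<phi>\<close> is not in the space.  The signs
  keep the earlier humps from cancelling the current one.\<close>

lemma comp_bounded_imp_powers_bounded:
  fixes \<beta> :: "nat \<Rightarrow> real"
  assumes pos: "\<And>n. \<beta> n > 0" and bdd: "\<And>n. \<beta> n \<le> B"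
    and growth: "liminf (\<lambda>n. ereal (root n (\<beta> n))) \<ge> 1"
    and \<phi>: "\<phi> holomorphic_on ball 0 1" "\<phi> ` ball 0 1 \<subseteq> ball 0 1"
    and cb: "comp_bounded \<beta> \<phi>"
    and A: "\<And>n. has_taylor (\<lambda>z. \<phi> z ^ n) (A n)"
  shows "\<exists>K. \<forall>n N. (\<Sum>m\<le>N. (cmod (A n m))\<^sup>2 * \<beta> m) \<le> K * \<beta> n"
proof (rule ccontr)
  assume neg: "\<nexists>K. \<forall>n N. (\<Sum>m\<le>N. (cmod (A n m))\<^sup>2 * \<beta> m) \<le> K * \<beta> n"
  define Q where "Q N u = (\<Sum>m\<le>N. (cmod (u m))\<^sup>2 * \<beta> m)" for N u
  have B: "B > 0" using pos[of 0] bdd[of 0] by linarith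
  have QA: "Q N (A n) \<le> B" for N n
  proof -
    have "Q N (A n) \<le> (\<Sum>m\<le>N. (cmod (A n m))\<^sup>2 * B)"
      unfolding Q_def by (intro sum_mono mult_left_mono bdd) auto
    also have "\<dots> = (\<Sum>m<Suc N. (cmod (A n m))\<^sup>2) * B" by (simp add: sum_distrib_right lessThan_Suc_atMost)
    also have "\<dots> \<le> 1 * B"
      using B by (intro mult_right_mono self_map_power_taylor_sum_le_1[OF \<phi>(2) A]) auto
    finally show ?thesis by simp
  qed
  \<comment> \<open>A constant of at least \<open>B / d\<close> rules out indices below
    \<open>n0\<close>, where \<open>\<beta> n \<ge> d\<close> while \<open>Q\<close> never exceeds
    \<open>B\<close>. Hence violations occur arbitrarily far out.\<close>
  have large: "\<exists>n\<ge>n0. \<exists>N. Q N (A n) > K * \<beta> n" for n0 K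
  proof -
    define d where "d = Min (insert 1 (\<beta> ` {..<n0}))"
    have d: "d > 0" unfolding d_def using pos by (subst Min_gr_iff) auto
    obtain n N where nN: "Q N (A n) > max K (B / d) * \<beta> n"
      using neg unfolding Q_def by (metis not_le)
    have "n \<ge> n0"
    proof (rule ccontr)
      assume "\<not> n \<ge> n0"
      then have "d \<le> \<beta> n" unfolding d_def by (intro Min_le) auto
      then have "B \<le> B / d * \<beta> n" using B d by (simp add: field_simps)
      also have "\<dots> \<le> max K (B / d) * \<beta> n" using pos[of n] by (intro mult_right_mono) auto
      finally show False using nN QA[of N n] by linarith
    qed
    moreover have "K * \<beta> n \<le> max K (B / d) * \<beta> n" using pos[of n] by (intro mult_right_mono) auto
    ultimately show ?thesis using nN by (meson le_less_trans)
  qed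
  obtain j where j: "\<forall>f a. has_taylor f a \<longrightarrow> summable (\<lambda>n. (cmod (a n))\<^sup>2 * \<beta> n) \<longrightarrow>
      (\<exists>A. \<forall>k N b p. 2 ^ j * k \<le> N \<longrightarrow> has_taylor (f \<circ> \<phi>) b \<longrightarrow>
        has_taylor (\<lambda>z. \<Sum>n<N. a n * \<phi> z ^ n) p \<longrightarrow> (\<Sum>m\<le>k. (cmod (b m - p m))\<^sup>2) \<le> A)"
    using composition_tail_bound[OF pos growth \<phi>] by blast
  \<comment> \<open>The factor \<open>8 ^ k\<close> beats the squared coefficient
    \<open>(1/4) ^ k / \<beta> (\<nu> k)\<close> chosen below and leaves \<open>2 ^ k\<close>. The
    spacing in \<open>?R\<close> makes the tail bound, truncated at the next exponent, cover the
    coefficients up to \<open>N k\<close>.\<close>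
  let ?P = "\<lambda>k (n, N). Q N (A n) > 8 ^ k * \<beta> n"
  let ?R = "\<lambda>k (n, N) (n', N'). n < n' \<and> 2 ^ j * N \<le> (n' :: nat)"
  have "\<exists>h. \<forall>k. ?P k (h k) \<and> ?R k (h k) (h (Suc k))"
  proof (rule dependent_nat_choice)
    show "\<exists>x. ?P 0 x" using large[of 0 1] by auto
    fix x :: "nat \<times> nat" and k
    obtain n N where x: "x = (n, N)" by (cases x)
    obtain n' N' where "n' \<ge> Suc n + 2 ^ j * N" "Q N' (A n') > 8 ^ Suc k * \<beta> n'"
      using large by blast
    then show "\<exists>y. ?P (Suc k) y \<and> ?R k x y" unfolding x by (intro exI[of _ "(n', N')"]) auto
  qed
  then obtain h where Ph: "\<forall>k. ?P k (h k) \<and> ?R k (h k) (h (Suc k))" by (rule exE)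
  note h = Ph[THEN spec, THEN conjunct1] Ph[THEN spec, THEN conjunct2]
  define \<nu> where "\<nu> = fst \<circ> h"
  define N where "N = snd \<circ> h"
  have hump: "Q (N k) (A (\<nu> k)) > 8 ^ k * \<beta> (\<nu> k)" for k
    using h(1)[of k] by (simp add: \<nu>_def N_def case_prod_beta)
  have \<nu>_step: "\<nu> k < \<nu> (Suc k)" "2 ^ j * N k \<le> \<nu> (Suc k)" for k
    using h(2)[of k] by (auto simp: \<nu>_def N_def case_prod_beta)
  have \<nu>: "strict_mono \<nu>" using \<nu>_step(1) by (simp add: strict_mono_Suc_iff)
  \<comment> \<open>Hump \<open>k\<close> thereby contributes exactly \<open>(1/4) ^ k\<close> to
    the squared norm of \<open>f\<close>.\<close>
  define c where "c k = (1/2) ^ k / sqrt (\<beta> (\<nu> k))" for k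
  have c2: "(c k)\<^sup>2 = (1/4) ^ k / \<beta> (\<nu> k)" for k
    unfolding c_def power_divide real_sqrt_pow2[OF less_imp_le[OF pos]]
    by (simp add: power2_eq_square flip: power_mult_distrib)
  define v where "v k m = of_real (c k) * A (\<nu> k) m" for k m
  obtain e where e: "\<And>k. cmod (e k) = 1"
      "\<And>k. (\<Sum>m\<le>N k. (cmod (v k m))\<^sup>2 * \<beta> m) \<le> (\<Sum>m\<le>N k. (cmod (\<Sum>i\<le>k. e i * v i m))\<^sup>2 * \<beta> m)"
    by (rule sign_choice[where w = \<beta> and v = v and N = N], simp add: pos less_imp_le, rule that)
  have big: "2 ^ k \<le> Q (N k) (\<lambda>m. \<Sum>i\<le>k. e i * v i m)" for k
  proof -
    have "2 ^ k * \<beta> (\<nu> k) = (1/4) ^ k * (8 ^ k * \<beta> (\<nu> k))"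
      by (simp add: power_mult_distrib[symmetric] mult.assoc[symmetric])
    also have "\<dots> \<le> (1/4) ^ k * Q (N k) (A (\<nu> k))"
      using hump[of k] by (intro mult_left_mono) auto
    finally have "2 ^ k \<le> (c k)\<^sup>2 * Q (N k) (A (\<nu> k))"
      using pos[of "\<nu> k"] by (simp add: c2 field_simps)
    also have "\<dots> = Q (N k) (v k)"
      by (simp add: Q_def v_def norm_mult power_mult_distrib sum_distrib_left mult.assoc)
    also have "\<dots> \<le> Q (N k) (\<lambda>m. \<Sum>i\<le>k. e i * v i m)" unfolding Q_def by (rule e(2))
    finally show ?thesis .
  qed
  define x where "x n = (if n \<in> range \<nu> then e (inv \<nu> n) * of_real (c (inv \<nu> n)) else 0)" for n
  have x\<nu>: "x (\<nu> k) = e k * of_real (c k)" for k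
    using inv_f_f[OF strict_mono_imp_inj_on[OF \<nu>]] by (simp add: x_def)
  have "summable (\<lambda>k. (cmod (x (\<nu> k)))\<^sup>2 * \<beta> (\<nu> k))"
  proof -
    have "(cmod (x (\<nu> k)))\<^sup>2 * \<beta> (\<nu> k) = (1/4) ^ k" for k
      using c2[of k] pos[of "\<nu> k"] by (simp add: x\<nu> norm_mult e(1))
    then show ?thesis by (simp add: summable_geometric)
  qed
  then have sumx: "summable (\<lambda>n. (cmod (x n))\<^sup>2 * \<beta> n)"
    using summable_mono_reindex[OF \<nu>, of "\<lambda>n. (cmod (x n))\<^sup>2 * \<beta> n"] by (simp add: x_def)
  define f where "f z = (\<Sum>n. x n * z ^ n)" for z
  have f: "has_taylor f x" unfolding f_def by (rule H2_power_series[OF pos growth sumx])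
  have "in_H2 \<beta> f" unfolding in_H2_def
    using has_taylor_holomorphic[OF f] f sumx unfolding has_taylor_def by blast
  then have "in_H2 \<beta> (f \<circ> \<phi>)" using cb unfolding comp_bounded_def by blast
  then obtain b where b: "has_taylor (f \<circ> \<phi>) b" and sumb: "summable (\<lambda>n. (cmod (b n))\<^sup>2 * \<beta> n)"
    unfolding in_H2_def has_taylor_def by blast
  from j[rule_format, OF f sumx] obtain A' where A': "\<And>k N b p. 2 ^ j * k \<le> N \<Longrightarrow> has_taylor (f \<circ> \<phi>) b \<Longrightarrow>
      has_taylor (\<lambda>z. \<Sum>n<N. x n * \<phi> z ^ n) p \<Longrightarrow> (\<Sum>m\<le>k. (cmod (b m - p m))\<^sup>2) \<le> A'"
    by blast
  define G where "G = (\<Sum>n. (cmod (b n))\<^sup>2 * \<beta> n)"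
  \<comment> \<open>The right side is independent of \<open>k\<close>: \<open>A'\<close> controls
    the later humps and \<open>G\<close> is the squared norm of the composition.\<close>
  have "2 ^ k \<le> 2 * (A' * B) + 2 * G" for k
  proof -
    \<comment> \<open>Truncation just below \<open>\<nu> (Suc k)\<close> keeps exactly the humps 0
      to \<open>k\<close>.\<close>
    define p where "p m = (\<Sum>n<\<nu> (Suc k). x n * A n m)" for m
    have p: "has_taylor (\<lambda>z. \<Sum>n<\<nu> (Suc k). x n * \<phi> z ^ n) p"
      unfolding p_def by (intro has_taylor_sum has_taylor_scale A)
    have "p m = (\<Sum>i\<le>k. e i * v i m)" for m
    proof -
      have "p m = (\<Sum>n\<in>\<nu> ` {..k}. x n * A n m)"
        unfolding p_def
      proof (rule sum.mono_neutral_right)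
        show "\<nu> ` {..k} \<subseteq> {..<\<nu> (Suc k)}" using strict_mono_less[OF \<nu>] by auto
        show "\<forall>n\<in>{..<\<nu> (Suc k)} - \<nu> ` {..k}. x n * A n m = 0"
        proof
          fix n assume n: "n \<in> {..<\<nu> (Suc k)} - \<nu> ` {..k}"
          have "n \<notin> range \<nu>"
          proof
            assume "n \<in> range \<nu>"
            then obtain i where i: "n = \<nu> i" by blast
            then have "i < Suc k" using n strict_mono_less[OF \<nu>] by auto
            then show False using n i by auto
          qed
          then show "x n * A n m = 0" by (simp add: x_def)
        qed
      qed simp
      also have "\<dots> = (\<Sum>i\<le>k. x (\<nu> i) * A (\<nu> i) m)"
        using strict_mono_imp_inj_on[OF \<nu>] by (simp add: sum.reindex inj_on_subset)
      finally show ?thesis by (simp add: x\<nu> v_def mult.assoc)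
    qed
    then have "2 ^ k \<le> (\<Sum>m\<le>N k. (cmod (p m))\<^sup>2 * \<beta> m)" using big[of k] by (simp add: Q_def)
    also have "\<dots> \<le> 2 * (\<Sum>m\<le>N k. (cmod (p m - b m))\<^sup>2 * \<beta> m) + 2 * (\<Sum>m\<le>N k. (cmod (b m))\<^sup>2 * \<beta> m)"
      by (rule weighted_sum_square_triangle) (simp add: pos less_imp_le)
    finally have "2 ^ k \<le> 2 * (\<Sum>m\<le>N k. (cmod (p m - b m))\<^sup>2 * \<beta> m) + 2 * (\<Sum>m\<le>N k. (cmod (b m))\<^sup>2 * \<beta> m)" .
    moreover have "(\<Sum>m\<le>N k. (cmod (p m - b m))\<^sup>2 * \<beta> m) \<le> A' * B"
    proof -
      have "(\<Sum>m\<le>N k. (cmod (p m - b m))\<^sup>2 * \<beta> m) \<le> (\<Sum>m\<le>N k. (cmod (b m - p m))\<^sup>2) * B"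
        unfolding sum_distrib_right by (intro sum_mono mult_mono bdd) (auto simp: norm_minus_commute pos less_imp_le)
      also have "\<dots> \<le> A' * B" using B by (intro mult_right_mono A'[OF \<nu>_step(2) b p]) auto
      finally show ?thesis .
    qed
    moreover have "(\<Sum>m\<le>N k. (cmod (b m))\<^sup>2 * \<beta> m) \<le> G"
      unfolding G_def using pos by (intro sum_le_suminf sumb) (auto simp: less_imp_le)
    ultimately show ?thesis by linarith
  qed
  moreover obtain k where "2 * (A' * B) + 2 * G < 2 ^ k"
    using real_arch_pow[of 2 "2 * (A' * B) + 2 * G"] by auto
  ultimately show False by (meson not_le)
qed

section \<open>From contracting the index to the doubling condition\<close>

lemma Delta2_of_dilation:
  fixes \<beta> :: "nat \<Rightarrow> real"
  assumes pos: "\<And>n. \<beta> n > 0" and C: "C \<ge> 1" "\<And>m n. n \<le> m \<Longrightarrow> \<beta> m \<le> C * \<beta> n"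
    and l: "0 < l" "l < 1" and K: "\<And>n. \<beta> (nat \<lfloor>l * real n\<rfloor>) \<le> K * \<beta> n"
  shows "Delta2 \<beta>"
proof -
  define h where "h n = nat \<lfloor>l * real n\<rfloor>" for n
  have "0 < K * \<beta> 0" using pos[of 0] K[of 0] by simp
  then have K0: "K > 0" using pos[of 0] by (simp add: zero_less_mult_iff)
  have it: "\<beta> ((h ^^ i) n) \<le> K ^ i * \<beta> n \<and> real ((h ^^ i) n) \<le> l ^ i * real n" for i n
  proof (induction i)
    case (Suc i)
    have "\<beta> (h ((h ^^ i) n)) \<le> K * \<beta> ((h ^^ i) n)" using K by (simp add: h_def)
    also have "\<dots> \<le> K * (K ^ i * \<beta> n)" using Suc K0 by (intro mult_left_mono) auto
    finally have 1: "\<beta> ((h ^^ Suc i) n) \<le> K ^ Suc i * \<beta> n" by (simp add: mult.assoc)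
    have "real (h ((h ^^ i) n)) \<le> l * real ((h ^^ i) n)" using l by (simp add: h_def)
    also have "\<dots> \<le> l * (l ^ i * real n)" using Suc l by (intro mult_left_mono) auto
    finally show ?case using 1 by (simp add: mult.assoc)
  qed simp
  \<comment> \<open>After \<open>i\<close> contractions \<open>2 * n\<close> has dropped to at most
    \<open>n\<close>, where essential decrease applies.\<close>
  obtain i where i: "l ^ i < 1/2" using real_arch_pow_inv[of "1/2" l] l by auto
  have main: "\<beta> n \<le> C * K ^ i * \<beta> (2 * n)" for n
  proof -
    have "real ((h ^^ i) (2 * n)) \<le> l ^ i * real (2 * n)" using it by blast
    also have "\<dots> \<le> 1/2 * real (2 * n)" using i by (intro mult_right_mono) auto
    finally have "(h ^^ i) (2 * n) \<le> n" by simp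
    then have "\<beta> n \<le> C * \<beta> ((h ^^ i) (2 * n))" by (rule C)
    also have "\<dots> \<le> C * (K ^ i * \<beta> (2 * n))" using it C by (intro mult_left_mono) auto
    finally show ?thesis by (simp add: mult.assoc)
  qed
  \<comment> \<open>The minimum with 1/2 secures \<open>\<delta> < 1\<close>.\<close>
  define \<delta> where "\<delta> = min (1/2) (1 / (C * K ^ i))"
  have CK: "C * K ^ i > 0" using C K0 by simp
  have "\<delta> * \<beta> n \<le> \<beta> (2 * n)" for n
  proof -
    have "\<delta> * \<beta> n \<le> 1 / (C * K ^ i) * \<beta> n" unfolding \<delta>_def using pos[of n] by (intro mult_right_mono) auto
    also have "\<dots> \<le> \<beta> (2 * n)" using main[of n] CK by (simp add: pos_divide_le_eq mult.commute)
    finally show ?thesis .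
  qed
  moreover have "0 < \<delta>" "\<delta> < 1" using CK by (auto simp: \<delta>_def)
  ultimately show ?thesis unfolding Delta2_def by blast
qed

lemma comp_bounded_T_imp_Delta2:
  fixes \<beta> :: "nat \<Rightarrow> real" and a :: real
  assumes pos: "\<And>n. \<beta> n > 0" and dec: "ess_decreasing \<beta>"
    and growth: "liminf (\<lambda>n. ereal (root n (\<beta> n))) \<ge> 1"
    and a: "0 < a" "a < 1" and cb: "comp_bounded \<beta> (T (of_real a))"
  shows "Delta2 \<beta>"
proof -
  obtain C where C: "C \<ge> 1" "\<And>m n. n \<le> m \<Longrightarrow> \<beta> m \<le> C * \<beta> n"
    using dec unfolding ess_decreasing_def by blast
  define l where "l = 1 - a\<^sup>2 / 2"
  have "\<exists>b. has_taylor (\<lambda>z. T (of_real a) z ^ n) b" for n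
    by (rule holomorphic_has_taylor[of "\<lambda>z. T (of_real a) z ^ n"])
       (auto intro!: holomorphic_intros T_holomorphic a)
  then obtain A where A: "\<And>n. has_taylor (\<lambda>z. T (of_real a) z ^ n) (A n)" by metis
  \<comment> \<open>Essential decrease from index 0 supplies the uniform bound
    \<open>C * \<beta> 0\<close> on the weight.\<close>
  obtain K where K: "\<And>n N. (\<Sum>m\<le>N. (cmod (A n m))\<^sup>2 * \<beta> m) \<le> K * \<beta> n"
    using comp_bounded_imp_powers_bounded[OF pos C(2)[OF le0] growth T_holomorphic[OF a] T_maps_disc[OF a] cb A]
    by blast
  obtain \<kappa> n0 where \<kappa>: "\<kappa> > 0"
    "\<And>n b. n \<ge> n0 \<Longrightarrow> has_taylor (\<lambda>z. T (of_real a) z ^ n) b \<Longrightarrow>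
      \<kappa> \<le> (\<Sum>m\<le>nat \<lfloor>(1 - a\<^sup>2 / 2) * real n\<rfloor>. (cmod (b m))\<^sup>2)"
    by (rule T_power_low_frequency_mass[OF a], rule that)
  have large: "\<beta> (nat \<lfloor>l * real n\<rfloor>) \<le> C * K / \<kappa> * \<beta> n" if n: "n \<ge> n0" for n
  proof -
    define L where "L = nat \<lfloor>l * real n\<rfloor>"
    \<comment> \<open>Up to the factor \<open>C\<close>, \<open>\<beta> L\<close> is the smallest
      weight among indices up to \<open>L\<close>, so the low-frequency mass bounds the weighted
      norm of the power from below.\<close>
    have "\<kappa> * \<beta> L \<le> (\<Sum>m\<le>L. (cmod (A n m))\<^sup>2) * \<beta> L"
      using \<kappa>(2)[OF n A] pos[of L] unfolding L_def l_def by (intro mult_right_mono) auto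
    also have "\<dots> \<le> (\<Sum>m\<le>L. (cmod (A n m))\<^sup>2 * (C * \<beta> m))"
      unfolding sum_distrib_right by (intro sum_mono mult_left_mono C(2)) auto
    also have "\<dots> = C * (\<Sum>m\<le>L. (cmod (A n m))\<^sup>2 * \<beta> m)" by (simp add: sum_distrib_left mult_ac)
    also have "\<dots> \<le> C * (K * \<beta> n)" using C K by (intro mult_left_mono) auto
    finally show ?thesis using \<kappa>(1) by (simp add: L_def field_simps)
  qed
  define d where "d = Min (insert 1 (\<beta> ` {..<n0}))"
  have d: "d > 0" unfolding d_def using pos by (subst Min_gr_iff) auto
  \<comment> \<open>The second entry covers the finitely many \<open>n < n0\<close>, where
    \<open>\<beta> n \<ge> d\<close>.\<close>
  define K' where "K' = max (C * K / \<kappa>) (C * \<beta> 0 / d)"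
  have "\<beta> (nat \<lfloor>l * real n\<rfloor>) \<le> K' * \<beta> n" for n
  proof (cases "n \<ge> n0")
    case True
    have "C * K / \<kappa> * \<beta> n \<le> K' * \<beta> n" unfolding K'_def using pos[of n] by (intro mult_right_mono) auto
    then show ?thesis using large[OF True] by linarith
  next
    case False
    then have dn: "d \<le> \<beta> n" unfolding d_def by (intro Min_le) auto
    have "\<beta> (nat \<lfloor>l * real n\<rfloor>) \<le> C * \<beta> 0" by (rule C(2)) simp
    also have "\<dots> \<le> C * \<beta> 0 / d * \<beta> n"
      using mult_left_mono[OF dn, of "C * \<beta> 0"] C(1) pos[of 0] d by (simp add: pos_le_divide_eq)
    also have "\<dots> \<le> K' * \<beta> n" unfolding K'_def using pos[of n] by (intro mult_right_mono) auto
    finally show ?thesis .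
  qed
  moreover have "0 < l" "l < 1" using a power_le_one[of a 2] by (auto simp: l_def)
  ultimately show ?thesis by (intro Delta2_of_dilation[of \<beta> C l K'] pos C) auto
qed

theorem theorem1p1:
  fixes \<beta> :: "nat \<Rightarrow> real"
  assumes pos: "\<And>n. \<beta> n > 0"
    and dec: "ess_decreasing \<beta>"
    and growth: "liminf (\<lambda>n. ereal (root n (\<beta> n))) \<ge> 1"
  shows "((\<forall>\<phi>. symbol \<phi> \<longrightarrow> comp_bounded \<beta> \<phi>) \<longleftrightarrow>
           (\<forall>a::real. 0 < a \<and> a < 1 \<longrightarrow> comp_bounded \<beta> (T (complex_of_real a)))) \<and>
         ((\<forall>a::real. 0 < a \<and> a < 1 \<longrightarrow> comp_bounded \<beta> (T (complex_of_real a))) \<longleftrightarrow>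
           (\<exists>a::real. 0 < a \<and> a < 1 \<and> comp_bounded \<beta> (T (complex_of_real a)))) \<and>
         ((\<exists>a::real. 0 < a \<and> a < 1 \<and> comp_bounded \<beta> (T (complex_of_real a))) \<longleftrightarrow>
           Delta2 \<beta>)"
proof -
  have "\<forall>a::real. 0 < a \<and> a < 1 \<longrightarrow> comp_bounded \<beta> (T (complex_of_real a))"
    if "\<forall>\<phi>. symbol \<phi> \<longrightarrow> comp_bounded \<beta> \<phi>"
    using that T_symbol by blast
  moreover have "\<exists>a::real. 0 < a \<and> a < 1 \<and> comp_bounded \<beta> (T (complex_of_real a))"
    if "\<forall>a::real. 0 < a \<and> a < 1 \<longrightarrow> comp_bounded \<beta> (T (complex_of_real a))"
    using that[rule_format, of "1/2"] by (intro exI[of _ "1/2"]) simp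
  moreover have "Delta2 \<beta>"
    if "\<exists>a::real. 0 < a \<and> a < 1 \<and> comp_bounded \<beta> (T (complex_of_real a))"
    using that comp_bounded_T_imp_Delta2[OF pos dec growth] by blast
  moreover have "\<forall>\<phi>. symbol \<phi> \<longrightarrow> comp_bounded \<beta> \<phi>" if "Delta2 \<beta>"
    using Delta2_imp_comp_bounded[OF pos dec growth that] unfolding symbol_def by blast
  ultimately show ?thesis by blast
qed

end
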